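(* Let $k\equiv0\pmod 4$ be a positive integer and let $$f(\tau)=E_k(\tau)=1+\frac{(2\pi)^k}{\zeta(k)\Gamma(k)}\sum_{n=1}^\infty\sigma_{k-1}(n)e^{2\pi i n\tau}.$$ Then all zeros of the polynomial $$P_f(z):=\sum_{\substack{n=1\\ n\text{ odd}}}^{k-3}\binom{k-2}{n}i^{1-n}\Lambda_f'(n+1)z^{k-3-n}$$ lie on the unit circle.
   Context: $\sigma_{k-1}(n)=\sum_{d\mid n}d^{k-1}$. For $f=\sum_{n\ge0}a_ne^{2\pi in\tau}$, $L_f(s)=\sum_{n\ge1}a_nn^{-s}$ and $\Lambda_f(s)=(2\pi)^{-s}\Gamma(s)L_f(s)$, continued meromorphically to $\mathbb C$; $\Lambda_f'$ is its derivative.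
   Formalization: The case k = 4 is excluded: there P_f = 2Λ_f'(2), which vanishes by the functional equation Λ_f(4−s) = Λ_f(s), so P_f is the zero polynomial and not all its zeros lie on the unit circle. *)

theory Defs
  imports
    "HOL-Complex_Analysis.Complex_Analysis"
    "HOL-Computational_Algebra.Polynomial"
    "HOL-Number_Theory.Cong"
begin

definition divisor_sigma :: "nat \<Rightarrow> nat \<Rightarrow> nat" where
  "divisor_sigma j n = (\<Sum>d | d dvd n. d ^ j)"

text \<open>The series represents the Riemann zeta function only for \<open>s > 1\<close>; it is used only at
  integers \<open>k \<ge> 2\<close>.\<close>

definition zeta :: "real \<Rightarrow> real" where
  "zeta s = (\<Sum>n. 1 / real (Suc n) powr s)"

definition eisenstein :: "nat \<Rightarrow> complex \<Rightarrow> complex" where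
  "eisenstein k \<tau> =
     1 + complex_of_real ((2 * pi) ^ k / (zeta (real k) * Gamma (real k))) *
       (\<Sum>n. of_nat (divisor_sigma (k - 1) (Suc n)) *
             exp (2 * of_real pi * \<i> * of_nat (Suc n) * \<tau>))"

text \<open>The sequence \<open>a\<close> with \<open>f(\<tau>) = \<Sum>\<^sub>n a\<^sub>n e\<^bsup>2\<pi>in\<tau>\<^esup>\<close> on the upper half-plane. It is unique when it
  exists, by uniqueness of power series coefficients in \<open>q = e\<^bsup>2\<pi>i\<tau>\<^esup>\<close>.\<close>

definition fourier_coeff :: "(complex \<Rightarrow> complex) \<Rightarrow> nat \<Rightarrow> complex" where
  "fourier_coeff f =
     (THE a. \<forall>\<tau>. Im \<tau> > 0 \<longrightarrow>
        (\<lambda>n. a n * exp (2 * of_real pi * \<i> * of_nat n * \<tau>)) sums f \<tau>)"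

definition L_term :: "(complex \<Rightarrow> complex) \<Rightarrow> complex \<Rightarrow> nat \<Rightarrow> complex" where
  "L_term f s n = fourier_coeff f (Suc n) * of_nat (Suc n) powr (-s)"

definition L_series :: "(complex \<Rightarrow> complex) \<Rightarrow> complex \<Rightarrow> complex" where
  "L_series f s = (\<Sum>n. L_term f s n)"

text \<open>The meromorphic continuation to the whole plane of \<open>(2\<pi>)\<^bsup>-s\<^esup> \<Gamma>(s) L\<^sub>f(s)\<close>, given on some right
  half-plane where the Dirichlet series converges. Plain \<open>meromorphic_on\<close> leaves the values on a
  discrete set arbitrary; the ``nicely'' version removes all removable singularities (and puts
  the value \<open>0\<close> at poles), which makes the continuation unique as a function and its derivative
  meaningful at every point that is not a pole.\<close>

definition completed_L :: "(complex \<Rightarrow> complex) \<Rightarrow> complex \<Rightarrow> complex" where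
  "completed_L f =
     (THE g. g nicely_meromorphic_on UNIV \<and>
        (\<exists>c::real. \<forall>s. Re s > c \<longrightarrow>
           summable (L_term f s) \<and>
           g s = of_real (2 * pi) powr (-s) * Gamma s * L_series f s))"

text \<open>For \<open>k = 4\<close> and \<open>f = E\<^sub>4\<close> this is the zero polynomial: its only coefficient is
  \<open>2 \<Lambda>\<^sub>f'(2)\<close>, and \<open>\<Lambda>\<^sub>f'(2) = 0\<close> by the functional equation \<open>\<Lambda>\<^sub>f(4 - s) = \<Lambda>\<^sub>f(s)\<close>.\<close>

definition period_poly_deriv :: "nat \<Rightarrow> (complex \<Rightarrow> complex) \<Rightarrow> complex poly" where
  "period_poly_deriv k f =
     (\<Sum>n | n \<in> {1..k-3} \<and> odd n.
        monom (of_nat ((k - 2) choose n) * \<i> powi (1 - int n) *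
               deriv (completed_L f) (of_nat (n + 1)))
              (k - 3 - n))"

end

theory Submission
  imports Defs "HOL-Computational_Algebra.Fundamental_Theorem_Algebra"
begin

text \<open>
  Since \<open>L\<^sub>f(s)\<close> is a multiple of \<open>\<zeta>(s) \<zeta>(s - k + 1)\<close>, the functional equation of \<open>\<zeta>\<close> turns
  \<open>\<Lambda>\<^sub>f(s)\<close> into a positive multiple of
  \<open>\<Gamma>(s) \<Gamma>(k - s) cos(\<pi>s/2) \<zeta>(s) \<zeta>(k - s)\<close> on \<open>1 < Re s < k - 1\<close>. At \<open>s = 2m\<close> the factors
  \<open>\<Gamma>(s) \<Gamma>(k - s)\<close> and \<open>cos(\<pi>s/2)\<close> cancel the binomial coefficient and the power of \<open>\<i>\<close>, so the
  coefficients of \<open>P\<^sub>f\<close>, as a polynomial in \<open>z\<^sup>2\<close>, are proportional to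
  \<open>\<zeta>(s) \<zeta>(k - s) (\<psi>(s) - \<psi>(k - s)) + (\<zeta>(s) \<zeta>(k - s))'\<close>. This expression is odd under
  \<open>s \<mapsto> k - s\<close>, and it increases for \<open>s \<ge> k/2\<close> because \<open>\<psi>\<close> is increasing and \<open>\<zeta>(s) \<zeta>(k - s)\<close> is a
  convex function symmetric about \<open>k/2\<close>. An antireciprocal polynomial with coefficients increasing
  from the middle has all its zeros on the unit circle, by the theorem of Enestroem and Kakeya.

  The functional equation of \<open>\<zeta>\<close> is obtained on \<open>-1 < s < 0\<close> by writing \<open>\<zeta>(s)\<close> as the sum of the
  errors of the trapezoidal rule for \<open>x\<^bsup>-s\<^esup>\<close>. These are integrals of \<open>x\<^bsup>-s-2\<^esup>\<close> against a positive
  kernel; inserting \<open>\<Gamma>(s + 2) x\<^bsup>-s-2\<^esup> = \<integral> t\<^bsup>s+1\<^esup> e\<^bsup>-xt\<^esup> dt\<close> and the partial fractions of \<open>coth\<close>, all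
  interchanges are justified by positivity.
\<close>

section \<open>Integrals and the functional equation on a real interval\<close>

text \<open>Euler's integral for \<open>Gamma z\<close>, rescaled by \<open>t -> u * t\<close>. With
  \<open>nn_integral\<close>, every later interchange of sums and integrals rests on positivity and
  measurability alone.\<close>

lemma nn_integral_powr_exp:
  fixes z u :: real
  assumes z: "z > 0" and u: "u > 0"
  shows "(\<integral>\<^sup>+t\<in>{0<..}. ennreal (t powr (z - 1) * exp (- (u * t))) \<partial>lborel) = ennreal (Gamma z * u powr (-z))"
proof -
  have "ennreal (Gamma z) = (\<integral>\<^sup>+t. ennreal (indicator {0..} t * t powr (z - 1) / exp t) \<partial>lborel)"
    by (rule Gamma_conv_nn_integral_real[OF z])
  also have "\<dots> = ennreal \<bar>u\<bar> * (\<integral>\<^sup>+t. ennreal (indicator {0..} (0 + u * t) * (0 + u * t) powr (z - 1) / exp (0 + u * t)) \<partial>lborel)"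
    by (rule nn_integral_real_affine) (use u in auto)
  also have "(\<lambda>t. ennreal (indicator {0..} (0 + u * t) * (0 + u * t) powr (z - 1) / exp (0 + u * t)))
      = (\<lambda>t. ennreal (u powr (z - 1)) * (ennreal (t powr (z - 1) * exp (- (u * t))) * indicator {0<..} t))"
  proof
    fix t :: real
    show "ennreal (indicator {0..} (0 + u * t) * (0 + u * t) powr (z - 1) / exp (0 + u * t))
      = ennreal (u powr (z - 1)) * (ennreal (t powr (z - 1) * exp (- (u * t))) * indicator {0<..} t)"
      using u by (cases "t > 0"; cases "t = 0")
        (auto simp: indicator_def powr_mult exp_minus field_simps zero_le_mult_iff simp flip: ennreal_mult)
  qed
  also have "(\<integral>\<^sup>+t. ennreal (u powr (z - 1)) * (ennreal (t powr (z - 1) * exp (- (u * t))) * indicator {0<..} t) \<partial>lborel)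
     = ennreal (u powr (z - 1)) * (\<integral>\<^sup>+t\<in>{0<..}. ennreal (t powr (z - 1) * exp (- (u * t))) \<partial>lborel)"
    by (rule nn_integral_cmult) auto
  also have "ennreal \<bar>u\<bar> * (ennreal (u powr (z - 1)) * (\<integral>\<^sup>+t\<in>{0<..}. ennreal (t powr (z - 1) * exp (- (u * t))) \<partial>lborel))
     = ennreal (u powr z) * (\<integral>\<^sup>+t\<in>{0<..}. ennreal (t powr (z - 1) * exp (- (u * t))) \<partial>lborel)"
    using u by (simp add: powr_diff mult.assoc[symmetric] ennreal_mult[symmetric])
  finally have eq: "ennreal (Gamma z) = ennreal (u powr z) * (\<integral>\<^sup>+t\<in>{0<..}. ennreal (t powr (z - 1) * exp (- (u * t))) \<partial>lborel)" .
  have "ennreal (Gamma z * u powr (-z)) = ennreal (u powr (-z)) * ennreal (Gamma z)"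
    using z by (simp add: ennreal_mult[symmetric] mult.commute)
  also have "\<dots> = ennreal (u powr (-z) * u powr z) * (\<integral>\<^sup>+t\<in>{0<..}. ennreal (t powr (z - 1) * exp (- (u * t))) \<partial>lborel)"
    by (simp add: eq ennreal_mult mult.assoc)
  finally show ?thesis using u by (simp add: powr_minus)
qed

text \<open>Writing \<open>1 / (1 + v)\<close> as the integral of \<open>exp (- (1 + v) * u)\<close>
  over \<open>u > 0\<close> and exchanging the two integrals gives
  \<open>Gamma p * Gamma (1 - p)\<close>, which the reflection formula evaluates.\<close>

lemma nn_integral_powr_over_one_plus:
  fixes p :: real
  assumes p: "0 < p" "p < 1"
  shows "(\<integral>\<^sup>+v\<in>{0<..}. ennreal (v powr (p - 1) / (1 + v)) \<partial>lborel) = ennreal (pi / sin (pi * p))"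
proof -
  have 1: "ennreal (v powr (p - 1) / (1 + v)) * indicator {0<..} v =
     (\<integral>\<^sup>+u. ennreal (v powr (p - 1) * exp (- ((1 + v) * u))) * indicator {0<..} u * indicator {0<..} v \<partial>lborel)" for v :: real
  proof (cases "v > 0")
    case True
    have "(\<integral>\<^sup>+u. ennreal (v powr (p - 1) * exp (- ((1 + v) * u))) * indicator {0<..} u \<partial>lborel)
       = (\<integral>\<^sup>+u. ennreal (v powr (p - 1)) * (ennreal (u powr (1 - 1) * exp (- ((1 + v) * u))) * indicator {0<..} u) \<partial>lborel)"
      by (intro nn_integral_cong) (auto simp: indicator_def ennreal_mult)
    also have "\<dots> = ennreal (v powr (p - 1)) * (\<integral>\<^sup>+u\<in>{0<..}. ennreal (u powr (1 - 1) * exp (- ((1 + v) * u))) \<partial>lborel)"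
      by (rule nn_integral_cmult) auto
    also have "\<dots> = ennreal (v powr (p - 1) / (1 + v))"
      using True by (subst nn_integral_powr_exp) (auto simp: ennreal_mult[symmetric] powr_minus field_simps)
    finally show ?thesis using True by simp
  qed auto
  have 2: "(\<integral>\<^sup>+v. ennreal (v powr (p - 1) * exp (- ((1 + v) * u))) * indicator {0<..} u * indicator {0<..} v \<partial>lborel)
     = ennreal (Gamma p) * (ennreal (u powr ((1 - p) - 1) * exp (- (1 * u))) * indicator {0<..} u)" for u :: real
  proof (cases "u > 0")
    case True
    have "(\<integral>\<^sup>+v. ennreal (v powr (p - 1) * exp (- ((1 + v) * u))) * indicator {0<..} v \<partial>lborel)
       = (\<integral>\<^sup>+v. ennreal (exp (-u)) * (ennreal (v powr (p - 1) * exp (- (u * v))) * indicator {0<..} v) \<partial>lborel)"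
      by (intro nn_integral_cong) (auto simp: indicator_def ennreal_mult[symmetric] field_simps exp_add exp_diff exp_minus)
    also have "\<dots> = ennreal (exp (-u)) * (\<integral>\<^sup>+v\<in>{0<..}. ennreal (v powr (p - 1) * exp (- (u * v))) \<partial>lborel)"
      by (rule nn_integral_cmult) auto
    also have "\<dots> = ennreal (Gamma p) * ennreal (u powr ((1 - p) - 1) * exp (- u))"
      using True p by (subst nn_integral_powr_exp) (auto simp: ennreal_mult[symmetric] field_simps)
    finally show ?thesis using True by simp
  qed auto
  have "(\<integral>\<^sup>+v\<in>{0<..}. ennreal (v powr (p - 1) / (1 + v)) \<partial>lborel)
    = (\<integral>\<^sup>+v. (\<integral>\<^sup>+u. ennreal (v powr (p - 1) * exp (- ((1 + v) * u))) * indicator {0<..} u * indicator {0<..} v \<partial>lborel) \<partial>lborel)"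
    by (simp only: 1)
  also have "\<dots> = (\<integral>\<^sup>+u. (\<integral>\<^sup>+v. ennreal (v powr (p - 1) * exp (- ((1 + v) * u))) * indicator {0<..} u * indicator {0<..} v \<partial>lborel) \<partial>lborel)"
    by (rule lborel_pair.Fubini') auto
  also have "\<dots> = ennreal (Gamma p) * (\<integral>\<^sup>+u\<in>{0<..}. ennreal (u powr ((1 - p) - 1) * exp (- (1 * u))) \<partial>lborel)"
    unfolding 2 by (rule nn_integral_cmult) auto
  also have "\<dots> = ennreal (Gamma p * Gamma (1 - p))"
    using p by (subst nn_integral_powr_exp) (auto simp: ennreal_mult[symmetric])
  also have "Gamma p * Gamma (1 - p) = pi / sin (pi * p)"
  proof -
    have "complex_of_real (Gamma p * Gamma (1 - p)) = of_real (pi / sin (pi * p))"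
      using Gamma_reflection_complex[of "of_real p"]
      by (simp add: Gamma_complex_of_real[symmetric] sin_of_real[symmetric])
    thus ?thesis by (simp only: of_real_eq_iff)
  qed
  finally show ?thesis .
qed

text \<open>The substitution \<open>v = t^2 / A^2\<close> with \<open>p = (s + 1) / 2\<close>
  reduces this to the previous integral; the cosine is \<open>sin (pi * p)\<close>.\<close>

lemma nn_integral_powr_over_sum_squares:
  fixes s A :: real
  assumes s: "-1 < s" "s < 1" and A: "A > 0"
  shows "(\<integral>\<^sup>+t\<in>{0<..}. ennreal (t powr s / (A\<^sup>2 + t\<^sup>2)) \<partial>lborel)
           = ennreal (A powr (s - 1) * (pi / (2 * cos (pi * s / 2))))"
proof -
  define p where "p = (s + 1) / 2"
  define I where "I = pi / sin (pi * p)"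
  define f where "f = (\<lambda>v::real. v powr (p - 1) / (1 + v))"
  define g where "g = (\<lambda>t::real. t\<^sup>2 / A\<^sup>2)"
  have sinp: "sin (pi * p) = cos (pi * s / 2)"
  proof -
    have "pi * p = pi * s / 2 + pi / 2" by (simp add: p_def field_simps)
    thus ?thesis by (simp add: sin_add)
  qed
  have p: "0 < p" "p < 1" using s by (auto simp: p_def)
  have sin: "sin (pi * p) > 0" using p by (intro sin_gt_zero) (auto)
  hence I: "I \<ge> 0" by (simp add: I_def)
  have "((\<lambda>v. indicator {0<..} v * f v) has_integral I) UNIV"
  proof (rule nn_integral_has_integral)
    show "(\<lambda>v. indicator {0<..} v * f v) \<in> borel_measurable borel" by (simp add: f_def)
    have "(\<integral>\<^sup>+v. ennreal (indicator {0<..} v * f v) \<partial>lborel) = (\<integral>\<^sup>+v\<in>{0<..}. ennreal (v powr (p - 1) / (1 + v)) \<partial>lborel)"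
      by (intro nn_integral_cong) (auto simp: f_def indicator_def)
    also have "\<dots> = ennreal I" unfolding I_def by (rule nn_integral_powr_over_one_plus[OF p])
    finally show "(\<integral>\<^sup>+v. ennreal (indicator {0<..} v * f v) \<partial>lborel) = ennreal I" .
  qed (use I in \<open>auto simp: f_def indicator_def\<close>)
  also have "(\<lambda>v. indicator {0<..} v * f v) = (\<lambda>v. if v \<in> {0<..} then f v else 0)"
    by (auto simp: indicator_def)
  finally have "(f has_integral I) {0<..}"
    by (subst (asm) has_integral_restrict_UNIV)
  hence f: "f absolutely_integrable_on {0<..} \<and> integral {0<..} f = I"
    by (auto intro!: nonnegative_absolutely_integrable_1 simp: f_def)
  have g: "g ` {0<..} = {0<..}"
  proof (intro equalityI subsetI)
    fix y :: real assume "y \<in> {0<..}"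
    thus "y \<in> g ` {0<..}" using A
      by (intro image_eqI[of _ _ "A * sqrt y"]) (auto simp: g_def power_mult_distrib)
  qed (use A in \<open>auto simp: g_def\<close>)
  have "(\<lambda>t. \<bar>2 * t / A\<^sup>2\<bar> * f (g t)) absolutely_integrable_on {0<..} \<and> integral {0<..} (\<lambda>t. \<bar>2 * t / A\<^sup>2\<bar> * f (g t)) = I"
  proof (subst has_absolute_integral_change_of_variables_1'[of _ g])
    show "(g has_field_derivative 2 * t / A\<^sup>2) (at t within {0<..})" for t
      using A unfolding g_def by (auto intro!: derivative_eq_intros simp: eval_nat_numeral)
    show "inj_on g {0<..}" using A by (auto simp: g_def inj_on_def)
    show "f absolutely_integrable_on g ` {0<..} \<and> integral (g ` {0<..}) f = I"
      unfolding g by (rule f)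
  qed auto
  hence "((\<lambda>t. \<bar>2 * t / A\<^sup>2\<bar> * f (g t)) has_integral I) {0<..}"
    using absolutely_integrable_on_def has_integral_iff by blast
  \<comment> \<open>This constant removes the powers of \<open>A\<close> and the factor 2 that the
    Jacobian leaves behind.\<close>
  hence "((\<lambda>t. (A powr (s - 1) / 2) * (\<bar>2 * t / A\<^sup>2\<bar> * f (g t))) has_integral (A powr (s - 1) / 2) * I) {0<..}"
    by (rule has_integral_mult_right)
  hence "((\<lambda>t. t powr s / (A\<^sup>2 + t\<^sup>2)) has_integral (A powr (s - 1) / 2) * I) {0<..}"
  proof (rule has_integral_eq[rotated])
    fix t :: real assume "t \<in> {0<..}"
    hence t: "t > 0" by simp
    have "(t\<^sup>2 / A\<^sup>2) powr (p - 1) = (t / A) powr (s - 1)"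
    proof -
      have "(t\<^sup>2 / A\<^sup>2) = (t / A) powr 2" using t A by (simp add: power_divide)
      moreover have "2 * (p - 1) = s - 1" by (simp add: p_def field_simps)
      ultimately show ?thesis by (simp add: powr_powr)
    qed
    also have "\<dots> = t powr s / t / A powr (s - 1)"
      using t A by (simp add: powr_divide powr_diff)
    finally show "A powr (s - 1) / 2 * (\<bar>2 * t / A\<^sup>2\<bar> * f (g t)) = t powr s / (A\<^sup>2 + t\<^sup>2)"
      using t A by (simp add: f_def g_def divide_simps add_pos_pos mult_ac)
  qed
  from nn_integral_has_integral_lebesgue'[OF _ this] show ?thesis
    by (simp add: I_def sinp mult.commute)
qed

text \<open>The limit is \<open>coth (t / 2)\<close> without its polar part \<open>2 / t\<close>.
  The expansion comes from the logarithmic derivative of the reflection formula at a point of the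
  imaginary axis, together with the series of \<open>Digamma\<close>.\<close>

lemma coth_partial_fractions:
  fixes t :: real
  assumes t: "t > 0"
  shows "(\<lambda>m. 4 * t / ((2 * pi * real (Suc m))\<^sup>2 + t\<^sup>2)) sums ((1 + exp (-t)) / (1 - exp (-t)) - 2 / t)"
proof -
  define z where "z = \<i> * of_real (t / (2 * pi))"
  define G where "G = Gamma (1 + z) * Gamma (1 - z)"
  have z0: "z \<noteq> 0" using t by (simp add: z_def)
  have Re: "Re z = 0" by (simp add: z_def)
  have nonpos: "w \<notin> \<int>\<^sub>\<le>\<^sub>0" if "Re w > 0" for w :: complex
    using that by (auto elim!: nonpos_Ints_cases)
  \<comment> \<open>In this product form the reflection formula has no singularity at
    \<open>w = 0\<close> and holds on a whole open strip, so it may be differentiated at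
    \<open>z\<close>.\<close>
  have refl: "Gamma (1 + w) * Gamma (1 - w) * sin (of_real pi * w) = of_real pi * w" if "\<bar>Re w\<bar> < 1" for w
  proof (cases "w = 0")
    case False
    have "w \<notin> \<int>" using that False by (auto elim!: Ints_cases)
    hence "sin (of_real pi * w) \<noteq> 0"
      by (auto simp: sin_eq_0 elim!: Ints_cases)
    moreover have "Gamma (1 + w) = w * Gamma w"
      using \<open>w \<notin> \<int>\<close> Gamma_plus1[of w] by (auto simp: add.commute)
    ultimately show ?thesis using Gamma_reflection_complex[of w] by (simp add: field_simps)
  qed auto
  have d1: "((\<lambda>w. Gamma (1 + w) * Gamma (1 - w) * sin (of_real pi * w)) has_field_derivative
      G * sin (of_real pi * z) * (Digamma (1 + z) - Digamma (1 - z)) + G * cos (of_real pi * z) * of_real pi) (at z)"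
    unfolding G_def
    by (rule derivative_eq_intros refl nonpos | simp add: Re)+ (simp add: algebra_simps)
  have "open {w. \<bar>Re w\<bar> < 1}"
    by (intro open_Collect_less continuous_intros)
  from d1 have "((\<lambda>w. of_real pi * w) has_field_derivative
      G * sin (of_real pi * z) * (Digamma (1 + z) - Digamma (1 - z)) + G * cos (of_real pi * z) * of_real pi) (at z)"
    by (rule has_field_derivative_transform_within_open[OF _ \<open>open {w. \<bar>Re w\<bar> < 1}\<close>]) (use Re refl in auto)
  moreover have "((\<lambda>w. of_real pi * w) has_field_derivative of_real pi) (at z)"
    by (auto intro!: derivative_eq_intros)
  \<comment> \<open>Differentiating both sides of the reflection formula gives an equation for
    \<open>Digamma (1 + z) - Digamma (1 - z)\<close>.\<close>
  ultimately have "G * sin (of_real pi * z) * (Digamma (1 + z) - Digamma (1 - z)) + G * cos (of_real pi * z) * of_real pi = of_real pi"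
    by (rule DERIV_unique)
  moreover have Gs: "G * sin (of_real pi * z) = of_real pi * z"
    unfolding G_def using Re by (intro refl) auto
  ultimately have eq: "of_real pi * z * (Digamma (1 + z) - Digamma (1 - z)) + G * cos (of_real pi * z) * of_real pi = of_real pi"
    by simp
  have sin0: "sin (of_real pi * z) \<noteq> 0" using Gs z0 by auto
  have G: "G = of_real pi * z / sin (of_real pi * z)" using Gs sin0 by (simp add: field_simps)
  have psi: "Digamma (1 + z) - Digamma (1 - z) = 1 / z - of_real pi * (cos (of_real pi * z) / sin (of_real pi * z))"
  proof -
    have "of_real pi * (z * (Digamma (1 + z) - Digamma (1 - z)) + G * cos (of_real pi * z)) = of_real pi * 1"
      using eq by (simp add: algebra_simps)
    hence "z * (Digamma (1 + z) - Digamma (1 - z)) + G * cos (of_real pi * z) = 1"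
      by (subst (asm) mult_cancel_left) auto
    thus ?thesis using z0 sin0 unfolding G by (simp add: divide_simps) (auto simp: algebra_simps)
  qed
  have iz: "\<i> * (of_real pi * z) = of_real (-t/2)" by (simp add: z_def)
  \<comment> \<open>Since \<open>i * pi * z = - t / 2\<close>, sine and cosine at
    \<open>pi * z\<close> are rational expressions in \<open>E\<close>.\<close>
  define E where "E = exp (-t/2)"
  have E: "0 < E" "E < 1" using t by (auto simp: E_def)
  have E2: "exp (-t) = E * E" by (simp add: E_def exp_add[symmetric])
  have "exp (\<i> * (of_real pi * z)) = of_real E" "exp (- (\<i> * (of_real pi * z))) = of_real (inverse E)"
    unfolding iz by (simp_all add: E_def exp_of_real[symmetric] exp_minus[symmetric])
  hence cs: "cos (of_real pi * z) = of_real ((E + inverse E) / 2)" "sin (of_real pi * z) = -\<i> * of_real ((E - inverse E) / 2)"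
    by (simp_all add: cos_exp_eq sin_exp_eq)
  have "of_real a / (-\<i> * of_real b) = \<i> * of_real (a / b)" for a b :: real
    by (cases "b = 0") (auto simp: field_simps)
  from this[of "(E + inverse E) / 2" "(E - inverse E) / 2"]
  have "cos (of_real pi * z) / sin (of_real pi * z) = \<i> * of_real ((E + inverse E) / (E - inverse E))"
    unfolding cs by (simp only: divide_divide_eq_right) (simp only: times_divide_eq_left nonzero_mult_div_cancel_right zero_neq_numeral not_False_eq_True)
  also have "(E + inverse E) / (E - inverse E) = - ((1 + E * E) / (1 - E * E))"
  proof -
    have "E * E < 1" using E mult_strict_mono[of E 1 E 1] by auto
    thus ?thesis using E by (simp add: divide_simps) (auto simp: algebra_simps)
  qed
  finally have cot: "cos (of_real pi * z) / sin (of_real pi * z) = - \<i> * of_real ((1 + exp (-t)) / (1 - exp (-t)))"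
    by (simp add: E2)
  have D: "(\<lambda>k. inverse (of_nat (Suc k)) - inverse (w + of_nat k)) sums (Digamma w + euler_mascheroni)"
    if "Re w > 0" for w :: complex
    using summable_Digamma[of w] nonpos[OF that] that by (auto simp: Digamma_def intro!: summable_sums)
  have "(\<lambda>k. inverse (1 - z + of_nat k) - inverse (1 + z + of_nat k)) sums (Digamma (1 + z) - Digamma (1 - z))"
    using sums_diff[OF D[of "1 + z"] D[of "1 - z"]] Re by (simp add: algebra_simps)
  also have "(\<lambda>k. inverse (1 - z + of_nat k) - inverse (1 + z + of_nat k)) =
      (\<lambda>k. \<i> * of_real pi * of_real (4 * t / ((2 * pi * real (Suc k))\<^sup>2 + t\<^sup>2)))"
  proof
    fix k
    have nz: "1 - z + of_nat k \<noteq> 0" "1 + z + of_nat k \<noteq> 0"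
      using Re by (auto simp: complex_eq_iff)
    have "inverse (1 - z + of_nat k) - inverse (1 + z + of_nat k) = 2 * z / ((1 - z + of_nat k) * (1 + z + of_nat k))"
      using nz by (simp add: field_simps)
    also have "(1 - z + of_nat k) * (1 + z + of_nat k) = of_real (((2 * pi * real (Suc k))\<^sup>2 + t\<^sup>2) / (4 * pi\<^sup>2))"
    proof -
      have "(1 - z + of_nat k) * (1 + z + of_nat k) = of_nat (Suc k) ^ 2 - z ^ 2"
        by (simp add: algebra_simps power2_eq_square)
      also have "z ^ 2 = of_real (- (t\<^sup>2 / (2 * pi)\<^sup>2))"
        by (simp add: z_def power_mult_distrib power_divide)
      also have "of_nat (Suc k) ^ 2 - \<dots> = complex_of_real (real (Suc k) ^ 2 + t\<^sup>2 / (2 * pi)\<^sup>2)"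
        by simp
      also have "real (Suc k) ^ 2 + t\<^sup>2 / (2 * pi)\<^sup>2 = ((2 * pi * real (Suc k))\<^sup>2 + t\<^sup>2) / (4 * pi\<^sup>2)"
        by (simp add: power_mult_distrib add_divide_distrib del: of_nat_Suc)
      finally show ?thesis .
    qed
    also have "2 * z / \<dots> = \<i> * of_real pi * of_real (4 * t / ((2 * pi * real (Suc k))\<^sup>2 + t\<^sup>2))"
      by (simp add: z_def power2_eq_square)
    finally show "inverse (1 - z + of_nat k) - inverse (1 + z + of_nat k) =
        \<i> * of_real pi * of_real (4 * t / ((2 * pi * real (Suc k))\<^sup>2 + t\<^sup>2))" .
  qed
  also have "Digamma (1 + z) - Digamma (1 - z) = \<i> * of_real pi * of_real ((1 + exp (-t)) / (1 - exp (-t)) - 2 / t)"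
    unfolding psi cot using t by (simp add: z_def field_simps)
  finally have "(\<lambda>k. complex_of_real (4 * t / ((2 * pi * real (Suc k))\<^sup>2 + t\<^sup>2))) sums of_real ((1 + exp (-t)) / (1 - exp (-t)) - 2 / t)"
    by (subst (asm) sums_mult_iff) auto
  thus ?thesis by (subst (asm) sums_of_real_iff)
qed

section \<open>The kernel \<open>(x - c) * (c + 1 - x)\<close> of the trapezoidal rule on a unit
  interval\<close>

lemma nn_integral_kernel_exp:
  fixes t c :: real
  assumes t: "t > 0"
  shows "(\<integral>\<^sup>+x\<in>{c..c+1}. ennreal ((x - c) * (c + 1 - x) * exp (- (x * t))) \<partial>lborel)
    = ennreal (exp (- (c * t)) * ((1 + exp (-t)) / t\<^sup>2 - 2 * (1 - exp (-t)) / t^3))"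
proof -
  \<comment> \<open>Repeated integration by parts: with \<open>w\<close> the quadratic kernel,
    \<open>F\<close> is \<open>- exp (- x * t) * (w / t + w' / t^2 + w'' / t^3)\<close>.\<close>
  define F where "F = (\<lambda>x. - exp (- (x * t)) * ((x - c) * (c + 1 - x) / t + (1 - 2 * (x - c)) / t\<^sup>2 - 2 / t^3))"
  have "((\<lambda>x. (x - c) * (c + 1 - x) * exp (- (x * t))) has_integral (F (c + 1) - F c)) {c..c+1}"
    unfolding F_def
    by (rule fundamental_theorem_of_calculus)
       (use t in \<open>auto intro!: derivative_eq_intros simp flip: has_real_derivative_iff_has_vector_derivative
          simp: field_simps power2_eq_square power3_eq_cube\<close>)
  moreover have "F (c + 1) - F c = exp (- (c * t)) * ((1 + exp (-t)) / t\<^sup>2 - 2 * (1 - exp (-t)) / t^3)"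
  proof -
    have "exp (- ((c + 1) * t)) = exp (- (c * t)) * exp (-t)" by (simp add: exp_add[symmetric] algebra_simps)
    thus ?thesis unfolding F_def using t
      by (simp only:) (simp add: field_simps)
  qed
  ultimately have "((\<lambda>x. (x - c) * (c + 1 - x) * exp (- (x * t))) has_integral
     exp (- (c * t)) * ((1 + exp (-t)) / t\<^sup>2 - 2 * (1 - exp (-t)) / t^3)) {c..c+1}" by simp
  thus ?thesis
    by (intro nn_integral_has_integral_lebesgue') auto
qed

text \<open>Peano's kernel formula for the trapezoidal rule, by two integrations by parts. The value
  is \<open>2 * (s - 1)\<close> times the difference between the trapezoidal approximation and the
  exact integral of \<open>x powr (-s)\<close>.\<close>

lemma has_integral_kernel_powr:
  fixes s c :: real
  assumes c: "c > 0"
  shows "((\<lambda>x. (s - 1) * s * (s + 1) * ((x - c) * (c + 1 - x) * x powr (- s - 2))) has_integral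
     ((s - 1) * (c powr (-s) + (c + 1) powr (-s)) + 2 * ((c + 1) powr (1 - s) - c powr (1 - s)))) {c..c+1}"
proof -
  define F where "F = (\<lambda>x. (s - 1) * ((x - c) * (c + 1 - x) * (- s * x powr (- s - 1)) - (2 * c + 1 - 2 * x) * x powr (- s)) + 2 * x powr (1 - s))"
  have "((\<lambda>x. (s - 1) * s * (s + 1) * ((x - c) * (c + 1 - x) * x powr (- s - 2))) has_integral (F (c + 1) - F c)) {c..c+1}"
    unfolding F_def
  proof (rule fundamental_theorem_of_calculus)
    fix x :: real assume "x \<in> {c..c+1}"
    hence x: "x > 0" using c by auto
    define P where "P = x powr (- s - 2)"
    have p: "x powr (- s - 2) = P" "x powr (- 2 - s) = P" "x powr (- s - 1) = P * x" "x powr (-s) = P * x * x" "x powr (1 - s) = P * x * x * x"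
      using x by (simp_all add: P_def powr_diff powr_minus field_simps power2_eq_square)
    have d: "((\<lambda>x. x powr (- s - 1)) has_real_derivative (- s - 1) * P) (at x within T)"
            "((\<lambda>x. x powr (- s)) has_real_derivative (- s) * (P * x)) (at x within T)"
            "((\<lambda>x. x powr (1 - s)) has_real_derivative (1 - s) * (P * x * x)) (at x within T)" for T
      using x has_real_derivative_powr[of x "- s - 1"] has_real_derivative_powr[of x "-s"] has_real_derivative_powr[of x "1 - s"]
      by (simp_all add: p P_def[symmetric] has_field_derivative_at_within)
    show "((\<lambda>x. (s - 1) * ((x - c) * (c + 1 - x) * (- s * x powr (- s - 1)) - (2 * c + 1 - 2 * x) * x powr (- s)) + 2 * x powr (1 - s))
      has_vector_derivative (s - 1) * s * (s + 1) * ((x - c) * (c + 1 - x) * x powr (- s - 2))) (at x within {c..c+1})"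
      unfolding has_real_derivative_iff_has_vector_derivative[symmetric]
      by (rule derivative_eq_intros d refl)+ (simp add: p algebra_simps)
  qed auto
  moreover have "F (c + 1) - F c = (s - 1) * (c powr (-s) + (c + 1) powr (-s)) + 2 * ((c + 1) powr (1 - s) - c powr (1 - s))"
    unfolding F_def by (simp add: algebra_simps)
  ultimately show ?thesis by simp
qed

text \<open>The case \<open>c = 0\<close>, where the integrand may be singular at 0. Cancelling
  \<open>x\<close> in the boundary term yields an antiderivative that is continuous on the closed
  interval because \<open>-s > 0\<close>; differentiability is then asked for in the interior
  only.\<close>

lemma has_integral_kernel_powr_0:
  fixes s :: real
  assumes s: "-1 < s" "s < 0"
  shows "((\<lambda>x. (s - 1) * s * (s + 1) * (x * (1 - x) * x powr (- s - 2))) has_integral (s + 1)) {0..1}"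
proof -
  define F where "F = (\<lambda>x. (s - 1) * (- s * (1 - x) * x powr (-s) - (1 - 2 * x) * x powr (- s)) + 2 * x powr (1 - s))"
  have "((\<lambda>x. (s - 1) * s * (s + 1) * (x * (1 - x) * x powr (- s - 2))) has_integral (F 1 - F 0)) {0..1}"
    unfolding F_def
  proof (rule fundamental_theorem_of_calculus_interior)
    fix x :: real assume "x \<in> {0<..<1}"
    hence x: "x > 0" by auto
    define P where "P = x powr (- s - 2)"
    have p: "x powr (- s - 2) = P" "x powr (- 2 - s) = P" "x powr (- s - 1) = P * x" "x powr (-s) = P * x * x" "x powr (1 - s) = P * x * x * x"
      using x by (simp_all add: P_def powr_diff powr_minus field_simps power2_eq_square)
    have d: "((\<lambda>x. x powr (- s - 1)) has_real_derivative (- s - 1) * P) (at x within T)"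
            "((\<lambda>x. x powr (- s)) has_real_derivative (- s) * (P * x)) (at x within T)"
            "((\<lambda>x. x powr (1 - s)) has_real_derivative (1 - s) * (P * x * x)) (at x within T)" for T
      using x has_real_derivative_powr[of x "- s - 1"] has_real_derivative_powr[of x "-s"] has_real_derivative_powr[of x "1 - s"]
      by (simp_all add: p P_def[symmetric] has_field_derivative_at_within)
    show "((\<lambda>x. (s - 1) * (- s * (1 - x) * x powr (-s) - (1 - 2 * x) * x powr (- s)) + 2 * x powr (1 - s))
      has_vector_derivative (s - 1) * s * (s + 1) * (x * (1 - x) * x powr (- s - 2))) (at x)"
      unfolding has_real_derivative_iff_has_vector_derivative[symmetric]
      by (rule derivative_eq_intros d refl)+ (simp add: p algebra_simps)
  next
    show "continuous_on {0..1} (\<lambda>x. (s - 1) * (- s * (1 - x) * x powr (-s) - (1 - 2 * x) * x powr (- s)) + 2 * x powr (1 - s))"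
    proof -
      have "continuous_on {0..1::real} (\<lambda>x. x powr (-s))" "continuous_on {0..1::real} (\<lambda>x. x powr (1 - s))"
        by (rule continuous_on_powr'; use s in \<open>auto intro: continuous_intros\<close>)+
      thus ?thesis
        by (intro continuous_on_add continuous_on_diff continuous_on_mult continuous_on_const continuous_on_id)
    qed
  qed auto
  moreover have "F 1 - F 0 = s + 1"
    unfolding F_def using s by (simp add: algebra_simps)
  ultimately show ?thesis by simp
qed

lemma has_integral_kernel_powr_nat:
  fixes s :: real and n :: nat
  assumes s: "-1 < s" "s < 0"
  shows "((\<lambda>x. (s - 1) * s * (s + 1) * ((x - real n) * (real n + 1 - x) * x powr (- s - 2))) has_integral
     ((s - 1) * (real n powr (-s) + (real n + 1) powr (-s)) + 2 * ((real n + 1) powr (1 - s) - real n powr (1 - s)))) {real n..real n + 1}"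
proof (cases "n = 0")
  case True
  thus ?thesis using has_integral_kernel_powr_0[OF s] by (simp add: add.commute)
next
  case False
  thus ?thesis using has_integral_kernel_powr[of "real n" s] by simp
qed

text \<open>The integral of \<open>w x * t powr (s + 1) * exp (- x * t)\<close> over
  \<open>x\<close> in \<open>[n, n + 1]\<close> and \<open>t > 0\<close> is computed in both orders:
  \<open>t\<close> first gives \<open>Gamma (s + 2) * x powr (- s - 2)\<close>, \<open>x\<close>
  first gives the Laplace transform of the kernel.\<close>

lemma nn_integral_Mellin_kernel:
  fixes s :: real and n :: nat
  assumes s: "-1 < s" "s < 0"
  shows "(\<integral>\<^sup>+t\<in>{0<..}. ennreal (t powr (s + 1) * (exp (- (real n * t)) * ((1 + exp (-t)) / t\<^sup>2 - 2 * (1 - exp (-t)) / t^3))) \<partial>lborel)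
     = ennreal (Gamma (s + 2) * (((s - 1) * (real n powr (-s) + (real n + 1) powr (-s)) + 2 * ((real n + 1) powr (1 - s) - real n powr (1 - s))) / ((s - 1) * s * (s + 1))))"
    (is "_ = ennreal (_ * (?U / ?\<kappa>))")
proof -
  have \<kappa>: "?\<kappa> > 0" using s by (intro mult_pos_pos mult_neg_neg) auto
  have Gamma_nonneg: "Gamma (s + 2) \<ge> 0" using s by simp
  define w where "w = (\<lambda>x. (x - real n) * (real n + 1 - x))"
  have w: "w x \<ge> 0" if "x \<in> {real n..real n + 1}" for x using that by (auto simp: w_def)
  have [measurable]: "w \<in> borel_measurable borel" by (simp add: w_def)
  let ?I = "\<lambda>x t. ennreal (w x * (t powr (s + 1) * exp (- (x * t)))) * indicator {0<..} t * indicator {real n..real n + 1} x"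
  have "((\<lambda>x. (1 / ?\<kappa>) * (?\<kappa> * (w x * x powr (- s - 2)))) has_integral (1 / ?\<kappa>) * ?U) {real n..real n + 1}"
    unfolding w_def by (intro has_integral_mult_right has_integral_kernel_powr_nat s)
  also have "(\<lambda>x. (1 / ?\<kappa>) * (?\<kappa> * (w x * x powr (- s - 2)))) = (\<lambda>x. w x * x powr (- s - 2))"
  proof -
    have "(1 / q) * (q * y) = y" if "q > 0" for q y :: real using that by simp
    thus ?thesis using \<kappa> by (intro ext)
  qed
  finally have "(\<integral>\<^sup>+x\<in>{real n..real n + 1}. ennreal (w x * x powr (- s - 2)) \<partial>lborel) = ennreal (?U / ?\<kappa>)"
    using nn_integral_has_integral_lebesgue'[of "{real n..real n + 1}" "\<lambda>x. w x * x powr (- s - 2)" "?U / ?\<kappa>"] w by simp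
  hence "ennreal (Gamma (s + 2) * (?U / ?\<kappa>)) = ennreal (Gamma (s + 2)) * (\<integral>\<^sup>+x\<in>{real n..real n + 1}. ennreal (w x * x powr (- s - 2)) \<partial>lborel)"
    by (simp only: ennreal_mult'[OF Gamma_nonneg])
  also have "\<dots> = (\<integral>\<^sup>+x. ennreal (Gamma (s + 2)) * (ennreal (w x * x powr (- s - 2)) * indicator {real n..real n + 1} x) \<partial>lborel)"
    by (rule nn_integral_cmult[symmetric]) auto
  also have "\<dots> = (\<integral>\<^sup>+x. (\<integral>\<^sup>+t. ?I x t \<partial>lborel) \<partial>lborel)"
  proof (rule nn_integral_cong)
    fix x :: real
    show "ennreal (Gamma (s + 2)) * (ennreal (w x * x powr (- s - 2)) * indicator {real n..real n + 1} x) = (\<integral>\<^sup>+t. ?I x t \<partial>lborel)"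
    proof (cases "x \<in> {real n..real n + 1} \<and> x > 0")
      case True
      hence x: "x \<in> {real n..real n + 1}" "x > 0" by auto
      have "(\<integral>\<^sup>+t. ?I x t \<partial>lborel) = (\<integral>\<^sup>+t. ennreal (w x) * (ennreal (t powr (s + 2 - 1) * exp (- (x * t))) * indicator {0<..} t) \<partial>lborel)"
        using w[OF x(1)] x by (intro nn_integral_cong) (auto simp: indicator_def ennreal_mult' add.commute)
      also have "\<dots> = ennreal (w x) * (\<integral>\<^sup>+t\<in>{0<..}. ennreal (t powr (s + 2 - 1) * exp (- (x * t))) \<partial>lborel)"
        by (rule nn_integral_cmult) auto
      also have "\<dots> = ennreal (w x * (Gamma (s + 2) * x powr (- (s + 2))))"
        using s x w[OF x(1)] by (subst nn_integral_powr_exp) (auto simp: ennreal_mult')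
      finally show ?thesis using s x w[OF x(1)] by (simp add: ennreal_mult'[symmetric] mult_ac)
    next
      case False
      \<comment> \<open>A non-positive \<open>x\<close> lies in the interval only as
        \<open>x = 0\<close> for \<open>n = 0\<close>, and there the weight vanishes.\<close>
      hence "w x = 0 \<or> x \<notin> {real n..real n + 1}" by (cases "n = 0") (auto simp: w_def)
      thus ?thesis by auto
    qed
  qed
  also have "\<dots> = (\<integral>\<^sup>+t. (\<integral>\<^sup>+x. ?I x t \<partial>lborel) \<partial>lborel)"
    by (rule lborel_pair.Fubini') auto
  also have "\<dots> = (\<integral>\<^sup>+t\<in>{0<..}. ennreal (t powr (s + 1) * (exp (- (real n * t)) * ((1 + exp (-t)) / t\<^sup>2 - 2 * (1 - exp (-t)) / t^3))) \<partial>lborel)"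
  proof (rule nn_integral_cong)
    fix t :: real
    show "(\<integral>\<^sup>+x. ?I x t \<partial>lborel) = ennreal (t powr (s + 1) * (exp (- (real n * t)) * ((1 + exp (-t)) / t\<^sup>2 - 2 * (1 - exp (-t)) / t^3))) * indicator {0<..} t"
    proof (cases "t > 0")
      case True
      have "(\<integral>\<^sup>+x. ?I x t \<partial>lborel) = (\<integral>\<^sup>+x. ennreal (t powr (s + 1)) * (ennreal (w x * exp (- (x * t))) * indicator {real n..real n + 1} x) \<partial>lborel)"
        using True by (intro nn_integral_cong) (auto simp: indicator_def ennreal_mult'[symmetric] mult_ac)
      also have "\<dots> = ennreal (t powr (s + 1)) * (\<integral>\<^sup>+x\<in>{real n..real n + 1}. ennreal (w x * exp (- (x * t))) \<partial>lborel)"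
        by (rule nn_integral_cmult) auto
      also have "\<dots> = ennreal (t powr (s + 1)) * ennreal (exp (- (real n * t)) * ((1 + exp (-t)) / t\<^sup>2 - 2 * (1 - exp (-t)) / t^3))"
        unfolding w_def by (subst nn_integral_kernel_exp[OF True]) (rule refl)
      finally show ?thesis using True by (simp add: ennreal_mult')
    qed auto
  qed
  finally show ?thesis by simp
qed

text \<open>The functional equation in disguise: the left side sums to
  \<open>(s - 1) * zeta(s)\<close>, and the series over \<open>m\<close> is
  \<open>zeta(1 - s)\<close>. Adding the Mellin integrals over \<open>n\<close> produces a geometric
  series in \<open>exp (-t)\<close>; the partial fractions of \<open>coth\<close> turn it into a sum
  over \<open>m\<close> that is integrated term by term.\<close>

lemma trapezoid_sums:
  fixes s :: real
  assumes s: "-1 < s" "s < 0"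
  shows "(\<lambda>n::nat. (s - 1) * (real n powr (-s) + (real n + 1) powr (-s)) / 2 + ((real n + 1) powr (1 - s) - real n powr (1 - s)))
     sums ((s - 1) * (2 * (2 * pi) powr (s - 1) * sin (pi * s / 2) * Gamma (1 - s) * (\<Sum>m. real (Suc m) powr (s - 1))))"
proof -
  define U where "U = (\<lambda>n::nat. (s - 1) * (real n powr (-s) + (real n + 1) powr (-s)) + 2 * ((real n + 1) powr (1 - s) - real n powr (1 - s)))"
  define \<kappa> where "\<kappa> = (s - 1) * s * (s + 1)"
  have \<kappa>: "\<kappa> > 0" unfolding \<kappa>_def using s by (intro mult_pos_pos mult_neg_neg) auto
  define Z where "Z = (\<Sum>m. real (Suc m) powr (s - 1))"
  have Z: "(\<lambda>m. real (Suc m) powr (s - 1)) sums Z"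
    unfolding Z_def using s by (subst summable_sums_iff[symmetric], subst summable_Suc_iff) (auto simp: summable_real_powr_iff)
  have Z0: "Z \<ge> 0" unfolding Z_def using Z by (intro suminf_nonneg) (auto simp: sums_iff)
  have ps: "- pi < pi * s" "pi * s < 0"
    using s mult_strict_left_mono[of "-1" s pi] by (auto simp: mult_less_0_iff)
  define c where "c = cos (pi * s / 2)"
  have c: "c > 0" unfolding c_def using ps by (intro cos_gt_zero_pi) linarith+
  \<comment> \<open>The Laplace transform of the kernel on \<open>[0, 1]\<close>; translation to
    \<open>[n, n + 1]\<close> multiplies it by \<open>exp (- n * t)\<close>.\<close>
  define b where "b = (\<lambda>t::real. (1 + exp (-t)) / t\<^sup>2 - 2 * (1 - exp (-t)) / t^3)"
  have [measurable]: "b \<in> borel_measurable borel" unfolding b_def by measurable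
  have b: "(\<lambda>m. 4 / (t * ((2 * pi * real (Suc m))\<^sup>2 + t\<^sup>2))) sums (b t / (1 - exp (-t)))" if t: "t > 0" for t
  proof -
    have "(\<lambda>m. 4 * t / ((2 * pi * real (Suc m))\<^sup>2 + t\<^sup>2) * (1 / t\<^sup>2)) sums (((1 + exp (-t)) / (1 - exp (-t)) - 2 / t) * (1 / t\<^sup>2))"
      by (intro sums_mult2 coth_partial_fractions t)
    moreover have "((1 + exp (-t)) / (1 - exp (-t)) - 2 / t) * (1 / t\<^sup>2) = b t / (1 - exp (-t))"
    proof -
      have "(e / q - 2 / t) * (1 / t\<^sup>2) = (e / t\<^sup>2 - 2 * q / t ^ 3) / q" if "q \<noteq> 0" for e q
        using that t by (simp add: field_simps power3_eq_cube power2_eq_square)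
      thus ?thesis unfolding b_def using t by simp
    qed
    moreover have "4 * t / ((2 * pi * real (Suc m))\<^sup>2 + t\<^sup>2) * (1 / t\<^sup>2) = 4 / (t * ((2 * pi * real (Suc m))\<^sup>2 + t\<^sup>2))" for m
      using t by (simp add: power2_eq_square)
    ultimately show ?thesis by simp
  qed
  \<comment> \<open>The sign of \<open>b\<close> is not visible in its formula; it is read off from
    the partial fractions.\<close>
  have b0: "b t \<ge> 0" if t: "t > 0" for t
  proof -
    have "0 \<le> (\<Sum>m. 4 / (t * ((2 * pi * real (Suc m))\<^sup>2 + t\<^sup>2)))"
      using b[OF t] t by (intro suminf_nonneg) (auto simp: sums_iff)
    thus ?thesis using b[OF t] t by (auto simp: sums_iff zero_le_divide_iff)
  qed
  have geo: "(\<Sum>n. ennreal (t powr (s + 1) * (exp (- (real n * t)) * b t))) = (\<Sum>m. ennreal (4 * (t powr s / ((2 * pi * real (Suc m))\<^sup>2 + t\<^sup>2))))"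
    if t: "t > 0" for t
  proof -
    have "(\<lambda>n. exp (-t) ^ n) sums (1 / (1 - exp (-t)))" using t by (intro geometric_sums) auto
    hence "(\<lambda>n. t powr (s + 1) * (exp (-t) ^ n * b t)) sums (t powr (s + 1) * (1 / (1 - exp (-t)) * b t))"
      by (intro sums_mult sums_mult2)
    hence "(\<lambda>n. t powr (s + 1) * (exp (- (real n * t)) * b t)) sums (t powr (s + 1) * (b t / (1 - exp (-t))))"
      by (simp add: exp_of_nat_mult[symmetric])
    hence 1: "(\<lambda>n. ennreal (t powr (s + 1) * (exp (- (real n * t)) * b t))) sums ennreal (t powr (s + 1) * (b t / (1 - exp (-t))))"
      using b0[OF t] t by (subst sums_ennreal) auto
    have *: "(\<lambda>m. t powr (s + 1) * (4 / (t * ((2 * pi * real (Suc m))\<^sup>2 + t\<^sup>2)))) sums (t powr (s + 1) * (b t / (1 - exp (-t))))"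
      by (intro sums_mult b t)
    have "(\<lambda>m. 4 * (t powr s / ((2 * pi * real (Suc m))\<^sup>2 + t\<^sup>2))) sums (t powr (s + 1) * (b t / (1 - exp (-t))))"
    proof -
      have "t powr (s + 1) * (4 / (t * D)) = 4 * (t powr s / D)" for D
        using t by (simp add: powr_add)
      with * show ?thesis by (simp only:)
    qed
    hence 2: "(\<lambda>m. ennreal (4 * (t powr s / ((2 * pi * real (Suc m))\<^sup>2 + t\<^sup>2)))) sums ennreal (t powr (s + 1) * (b t / (1 - exp (-t))))"
      using b0[OF t] t by (subst sums_ennreal) auto
    from 1 2 show ?thesis by (simp add: sums_iff)
  qed
  have U: "ennreal (Gamma (s + 2) * (U n / \<kappa>)) = (\<integral>\<^sup>+t\<in>{0<..}. ennreal (t powr (s + 1) * (exp (- (real n * t)) * b t)) \<partial>lborel)" for n :: nat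
    using nn_integral_Mellin_kernel[OF s, of n] unfolding U_def \<kappa>_def b_def by simp
  \<comment> \<open>Tonelli twice: the sum over \<open>n\<close> enters the integral,
    \<open>geo\<close> rewrites it as a sum over \<open>m\<close>, and that sum leaves the
    integral.\<close>
  have "(\<Sum>n. ennreal (Gamma (s + 2) * (U n / \<kappa>))) = (\<integral>\<^sup>+t. (\<Sum>n. ennreal (t powr (s + 1) * (exp (- (real n * t)) * b t)) * indicator {0<..} t) \<partial>lborel)"
    unfolding U by (rule nn_integral_suminf[symmetric]) auto
  also have "\<dots> = (\<integral>\<^sup>+t. (\<Sum>m. ennreal (4 * (t powr s / ((2 * pi * real (Suc m))\<^sup>2 + t\<^sup>2))) * indicator {0<..} t) \<partial>lborel)"
  proof (rule nn_integral_cong)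
    fix t :: real
    show "(\<Sum>n. ennreal (t powr (s + 1) * (exp (- (real n * t)) * b t)) * indicator {0<..} t) =
        (\<Sum>m. ennreal (4 * (t powr s / ((2 * pi * real (Suc m))\<^sup>2 + t\<^sup>2))) * indicator {0<..} t)"
    proof (cases "t > 0")
      case True
      hence "indicator {0<..} t = (1::ennreal)" by simp
      with geo[OF True] show ?thesis by (simp only: mult_1_right)
    qed simp
  qed
  also have "\<dots> = (\<Sum>m. \<integral>\<^sup>+t\<in>{0<..}. ennreal (4 * (t powr s / ((2 * pi * real (Suc m))\<^sup>2 + t\<^sup>2))) \<partial>lborel)"
    by (rule nn_integral_suminf) auto
  also have "\<dots> = (\<Sum>m. ennreal (2 * pi / c * (2 * pi) powr (s - 1) * real (Suc m) powr (s - 1)))"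
  proof (rule suminf_cong)
    fix m
    have "(\<integral>\<^sup>+t\<in>{0<..}. ennreal (4 * (t powr s / ((2 * pi * real (Suc m))\<^sup>2 + t\<^sup>2))) \<partial>lborel) =
       (\<integral>\<^sup>+t. ennreal 4 * (ennreal (t powr s / ((2 * pi * real (Suc m))\<^sup>2 + t\<^sup>2)) * indicator {0<..} t) \<partial>lborel)"
      by (intro nn_integral_cong) (simp only: ennreal_mult'[OF zero_le_numeral] mult.assoc)
    also have "\<dots> = ennreal 4 * (\<integral>\<^sup>+t\<in>{0<..}. ennreal (t powr s / ((2 * pi * real (Suc m))\<^sup>2 + t\<^sup>2)) \<partial>lborel)"
      by (rule nn_integral_cmult) auto
    also have "\<dots> = ennreal (4 * ((2 * pi * real (Suc m)) powr (s - 1) * (pi / (2 * c))))"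
    proof -
      have "(\<integral>\<^sup>+t\<in>{0<..}. ennreal (t powr s / ((2 * pi * real (Suc m))\<^sup>2 + t\<^sup>2)) \<partial>lborel) =
          ennreal ((2 * pi * real (Suc m)) powr (s - 1) * (pi / (2 * c)))"
        unfolding c_def by (rule nn_integral_powr_over_sum_squares) (use s in auto)
      thus ?thesis by (simp only: ennreal_mult'[OF zero_le_numeral])
    qed
    also have "4 * ((2 * pi * real (Suc m)) powr (s - 1) * (pi / (2 * c))) = 2 * pi / c * (2 * pi) powr (s - 1) * real (Suc m) powr (s - 1)"
      by (subst powr_mult) auto
    finally show "(\<integral>\<^sup>+t\<in>{0<..}. ennreal (4 * (t powr s / ((2 * pi * real (Suc m))\<^sup>2 + t\<^sup>2))) \<partial>lborel) =
      ennreal (2 * pi / c * (2 * pi) powr (s - 1) * real (Suc m) powr (s - 1))" .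
  qed
  also have "\<dots> = ennreal (2 * pi / c * (2 * pi) powr (s - 1) * Z)"
    using sums_mult[OF Z, of "2 * pi / c * (2 * pi) powr (s - 1)"] c Z0
    by (intro sums_unique[symmetric]) (subst sums_ennreal; auto)
  finally have eq: "(\<Sum>n. ennreal (Gamma (s + 2) * (U n / \<kappa>))) = ennreal (2 * pi / c * (2 * pi) powr (s - 1) * Z)" .
  have U0: "U n \<ge> 0" for n
    using has_integral_nonneg[OF has_integral_kernel_powr_nat[OF s, of n]] \<kappa> unfolding U_def \<kappa>_def
    by auto
  \<comment> \<open>The return from extended to real sums, possible since the terms are nonnegative
    and the value is finite.\<close>
  have "(\<lambda>n. Gamma (s + 2) * (U n / \<kappa>)) sums (2 * pi / c * (2 * pi) powr (s - 1) * Z)"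
  proof -
    have "(\<lambda>n. ennreal (Gamma (s + 2) * (U n / \<kappa>))) sums ennreal (2 * pi / c * (2 * pi) powr (s - 1) * Z)"
      unfolding eq[symmetric] by (intro summable_sums summableI)
    thus ?thesis using U0 \<kappa> s c Z0 by (subst (asm) sums_ennreal) auto
  qed
  note * = sums_mult[OF this, of "\<kappa> / (2 * Gamma (s + 2))"]
  have "(\<lambda>n. U n / 2) sums (\<kappa> / (2 * Gamma (s + 2)) * (2 * pi / c * (2 * pi) powr (s - 1) * Z))"
  proof -
    have "\<kappa> / (2 * Gamma (s + 2)) * (Gamma (s + 2) * (u / \<kappa>)) = u / 2" for u
      using \<kappa> Gamma_real_pos[of "s + 2"] s by (simp del: Gamma_real_pos)
    with * show ?thesis by (simp only:)
  qed
  \<comment> \<open>\<open>Gamma (s + 2) = (s + 1) * s * Gamma s\<close> cancels two factors of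
    \<open>\<kappa>\<close>; the reflection formula and the double angle formula then replace
    \<open>pi / (Gamma s * c)\<close> by
    \<open>2 * sin (pi * s / 2) * Gamma (1 - s)\<close>.\<close>
  also have "\<kappa> / (2 * Gamma (s + 2)) * (2 * pi / c * (2 * pi) powr (s - 1) * Z) =
     (s - 1) * (2 * (2 * pi) powr (s - 1) * sin (pi * s / 2) * Gamma (1 - s) * Z)"
  proof -
    have nonint: "s \<notin> \<int>" using s by (auto elim!: Ints_cases)
    hence "Gamma (s + 2) = (s + 1) * (s * Gamma s)"
    proof -
      have "s \<notin> \<int>\<^sub>\<le>\<^sub>0" using nonint nonpos_Ints_subset_Ints by blast
      moreover have "s + 1 \<notin> \<int>\<^sub>\<le>\<^sub>0" using s by (auto elim!: nonpos_Ints_cases)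
      ultimately show ?thesis using Gamma_plus1[of s] Gamma_plus1[of "s + 1"] by (simp add: add.assoc)
    qed
    moreover have "Gamma s * Gamma (1 - s) = pi / sin (pi * s)"
    proof -
      have "complex_of_real (Gamma s * Gamma (1 - s)) = of_real (pi / sin (pi * s))"
        using Gamma_reflection_complex[of "of_real s"]
        by (simp add: Gamma_complex_of_real[symmetric] sin_of_real[symmetric])
      thus ?thesis by (simp only: of_real_eq_iff)
    qed
    moreover have "sin (pi * s) = 2 * sin (pi * s / 2) * c"
      using sin_double[of "pi * s / 2"] by (simp add: c_def)
    moreover have "sin (pi * s / 2) < 0" using sin_gt_zero[of "- (pi * s / 2)"] ps by simp
    ultimately have 1: "Gamma (s + 2) = (s + 1) * (s * Gamma s)" and 2: "Gamma s * Gamma (1 - s) * (2 * sin (pi * s / 2) * c) = pi"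
      using c by auto
    hence "Gamma s \<noteq> 0" by auto
    hence "\<kappa> / (2 * Gamma (s + 2)) * (2 * pi / c) = (s - 1) * (pi / (Gamma s * c))"
      unfolding 1 \<kappa>_def using s c by (simp add: divide_simps)
    also have "pi / (Gamma s * c) = 2 * sin (pi * s / 2) * Gamma (1 - s)"
      using 2 \<open>Gamma s \<noteq> 0\<close> c by (simp add: divide_simps mult_ac)
    finally have "\<kappa> / (2 * Gamma (s + 2)) * (2 * pi / c) * ((2 * pi) powr (s - 1) * Z) =
      (s - 1) * (2 * sin (pi * s / 2) * Gamma (1 - s)) * ((2 * pi) powr (s - 1) * Z)" by simp
    thus ?thesis by (simp only: mult_ac)
  qed
  also have "(\<lambda>n. U n / 2) = (\<lambda>n::nat. (s - 1) * (real n powr (-s) + (real n + 1) powr (-s)) / 2 + ((real n + 1) powr (1 - s) - real n powr (1 - s)))"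
    by (simp add: U_def fun_eq_iff field_simps)
  finally show ?thesis unfolding Z_def .
qed

section \<open>Meromorphic continuation of the zeta function\<close>

text \<open>The Dirichlet series of the Riemann zeta function, which represents it only for
  \<open>Re s > 1\<close>; the continuation is \<open>zeta_cont\<close> below.\<close>

definition zeta_series :: "complex \<Rightarrow> complex" where
  "zeta_series s = (\<Sum>n. of_nat (Suc n) powr (-s))"

text \<open>The Weierstrass M-test makes the partial sums converge uniformly on small closed balls,
  and locally uniform limits of holomorphic functions are holomorphic.\<close>

lemma holomorphic_on_suminf_locally_dominated:
  fixes f :: "nat \<Rightarrow> complex \<Rightarrow> complex"
  assumes "open S" and "\<And>n. f n holomorphic_on S"
    and "\<And>x. x \<in> S \<Longrightarrow> \<exists>d M. 0 < d \<and> cball x d \<subseteq> S \<and> summable M \<and> (\<forall>n. \<forall>y\<in>cball x d. norm (f n y) \<le> M n)"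
  shows "(\<lambda>z. \<Sum>n. f n z) holomorphic_on S"
proof (rule holomorphic_uniform_sequence[OF \<open>open S\<close>])
  show "(\<lambda>z. \<Sum>i<n. f i z) holomorphic_on S" for n
    by (intro holomorphic_intros assms)
next
  fix x assume "x \<in> S"
  obtain d M where d: "0 < d" "cball x d \<subseteq> S" and M: "summable M" "\<forall>n. \<forall>y\<in>cball x d. norm (f n y) \<le> M n"
    using assms(3)[OF \<open>x \<in> S\<close>] by (elim exE conjE)
  have "uniform_limit (cball x d) (\<lambda>n z. \<Sum>i<n. f i z) (\<lambda>z. \<Sum>n. f n z) sequentially"
    by (rule Weierstrass_m_test[of _ _ M]) (use M in auto)
  with d show "\<exists>d>0. cball x d \<subseteq> S \<and> uniform_limit (cball x d) (\<lambda>n z. \<Sum>i<n. f i z) (\<lambda>z. \<Sum>n. f n z) sequentially"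
    by (intro exI[of _ d] conjI)
qed

section \<open>Convergence and holomorphy of the Dirichlet series of zeta\<close>

lemma norm_of_nat_Suc_powr: "norm (of_nat (Suc n) powr (s::complex)) = real (Suc n) powr Re s"
  by (subst norm_powr_real_powr) auto

lemma summable_Suc_powr:
  assumes "a < -1" shows "summable (\<lambda>n. real (Suc n) powr a)"
  using assms summable_Suc_iff[of "\<lambda>n. real n powr a"] summable_real_powr_iff[of a] by blast

lemma summable_zeta_series:
  assumes "Re s > 1" shows "summable (\<lambda>n. of_nat (Suc n) powr (-s))"
proof (rule summable_norm_cancel)
  show "summable (\<lambda>n. norm (of_nat (Suc n) powr (-s) :: complex))"
    unfolding norm_of_nat_Suc_powr using assms by (intro summable_Suc_powr) simp
qed

lemma cball_Re_ge:
  assumes "y \<in> cball x d" shows "Re y \<ge> Re x - d"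
  using assms abs_Re_le_cmod[of "x - y"] by (auto simp: dist_norm)

text \<open>Kept apart from holomorphy because termwise differentiation on the real axis uses the
  same majorant.\<close>

lemma zeta_series_locally_dominated:
  assumes "Re x > 1"
  shows "\<exists>d M. 0 < d \<and> cball x d \<subseteq> {s. Re s > 1} \<and> summable M \<and>
    (\<forall>n. \<forall>y\<in>cball x d. norm (of_nat (Suc n) powr (-y) :: complex) \<le> M n)"
proof -
  define d where "d = (Re x - 1) / 2"
  have y: "Re y \<ge> (Re x + 1) / 2" if "y \<in> cball x d" for y
    using cball_Re_ge[OF that] by (simp add: d_def field_simps)
  have "norm (of_nat (Suc n) powr (-y) :: complex) \<le> real (Suc n) powr (- ((Re x + 1) / 2))" if "y \<in> cball x d" for n y
    unfolding norm_of_nat_Suc_powr using y[OF that] by (intro powr_mono) auto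
  moreover have "cball x d \<subseteq> {s. Re s > 1}" using y assms by force
  moreover have "summable (\<lambda>n. real (Suc n) powr (- ((Re x + 1) / 2)))"
    using assms by (intro summable_Suc_powr) auto
  ultimately show ?thesis using assms
    by (intro exI[of _ d] exI[of _ "\<lambda>n. real (Suc n) powr (- ((Re x + 1) / 2))"]) (auto simp: d_def)
qed

lemma holomorphic_zeta_series: "zeta_series holomorphic_on {s. Re s > 1}"
  unfolding zeta_series_def
proof (rule holomorphic_on_suminf_locally_dominated)
  show "(\<lambda>s. of_nat (Suc n) powr (-s)) holomorphic_on {s. Re s > 1}" for n
    by (intro holomorphic_intros)
  show "\<exists>d M. 0 < d \<and> cball x d \<subseteq> {s. Re s > 1} \<and> summable M \<and>
      (\<forall>n. \<forall>y\<in>cball x d. norm (of_nat (Suc n) powr (-y) :: complex) \<le> M n)" if "x \<in> {s. Re s > 1}" for x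
    by (rule zeta_series_locally_dominated) (use that in simp)
qed (rule open_halfspace_Re_gt)

text \<open>\<open>s - 1\<close> times the error of the trapezoidal rule for
  \<open>x powr (-s)\<close> on \<open>[n + 1, n + 2]\<close>. The factor \<open>s - 1\<close>
  clears the denominator of the antiderivative, so every term is entire in \<open>s\<close>;
  starting at 1 keeps the base of the powers away from 0.\<close>

definition trapezoid_error :: "nat \<Rightarrow> complex \<Rightarrow> complex" where
  "trapezoid_error n s = (s - 1) * (of_nat (Suc n) powr (-s) + of_nat (Suc (Suc n)) powr (-s)) / 2
      + (of_nat (Suc (Suc n)) powr (1 - s) - of_nat (Suc n) powr (1 - s))"

text \<open>The kernel formula of \<open>has_integral_kernel_powr\<close> with complex
  \<open>s\<close>. The kernel is at most 1, and the power is largest at the left end because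
  \<open>Re s > -2\<close>. The bound is summable once \<open>Re s > -1\<close>.\<close>

lemma norm_trapezoid_error_le:
  assumes "Re s > -2"
  shows "norm (trapezoid_error n s) \<le> norm ((s - 1) * s * (s + 1)) / 2 * real (Suc n) powr (- Re s - 2)"
proof -
  define c where "c = real (Suc n)"
  have c: "c > 0" by (simp add: c_def)
  define F where "F = (\<lambda>x. (s - 1) * ((x - of_real c) * (of_real c + 1 - x) * (- s * x powr (- s - 1)) - (2 * of_real c + 1 - 2 * x) * x powr (- s)) + 2 * x powr (1 - s))"
  have "((\<lambda>x. (s - 1) * s * (s + 1) * (of_real ((x - c) * (c + 1 - x)) * of_real x powr (- s - 2))) has_integral (F (of_real (c + 1)) - F (of_real c))) {c..c+1}"
  proof (rule fundamental_theorem_of_calculus)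
    fix x :: real assume "x \<in> {c..c+1}"
    hence x: "x > 0" using c by auto
    define X where "X = complex_of_real x"
    have X: "X \<noteq> 0" "X \<notin> \<real>\<^sub>\<le>\<^sub>0" using x by (auto simp: X_def)
    define P where "P = X powr (- s - 2)"
    have p: "X powr (- s - 2) = P" "X powr (- s - 1) = P * X" "X powr (-s) = P * X * X" "X powr (1 - s) = P * X * X * X"
    proof -
      have e: "- s - 2 + 1 = - s - 1" "- s - 2 + 2 = - s" "- s - 2 + 3 = 1 - s" by simp_all
      show "X powr (- s - 2) = P" by (simp add: P_def)
      show "X powr (- s - 1) = P * X" "X powr (-s) = P * X * X" "X powr (1 - s) = P * X * X * X"
        using X powr_add[of X "- s - 2" 1] powr_add[of X "- s - 2" 2] powr_add[of X "- s - 2" 3] unfolding e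
        by (simp_all add: P_def power2_eq_square power3_eq_cube)
    qed
    have d: "((\<lambda>x. x powr (- s - 1)) has_field_derivative (- s - 1) * P) (at X)"
            "((\<lambda>x. x powr (- s)) has_field_derivative (- s) * (P * X)) (at X)"
            "((\<lambda>x. x powr (1 - s)) has_field_derivative (1 - s) * (P * X * X)) (at X)"
      using X has_field_derivative_powr[of X "- s - 1"] has_field_derivative_powr[of X "-s"] has_field_derivative_powr[of X "1 - s"]
      by (simp_all add: p P_def[symmetric] algebra_simps)
    have "(F has_field_derivative (s - 1) * s * (s + 1) * ((X - of_real c) * (of_real c + 1 - X) * P)) (at X)"
      unfolding F_def by (rule derivative_eq_intros d refl)+ (simp add: p algebra_simps)
    hence "((\<lambda>x. F (of_real x)) has_vector_derivative (s - 1) * s * (s + 1) * ((X - of_real c) * (of_real c + 1 - X) * P)) (at x within {c..c+1})"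
      unfolding X_def by (rule has_vector_derivative_real_field)
    thus "((\<lambda>x. F (of_real x)) has_vector_derivative
        (s - 1) * s * (s + 1) * (of_real ((x - c) * (c + 1 - x)) * of_real x powr (- s - 2))) (at x within {c..c+1})"
      by (simp add: P_def X_def)
  qed auto
  also have "F (of_real (c + 1)) - F (of_real c) = 2 * trapezoid_error n s"
  proof -
    have c': "complex_of_real c = of_nat (Suc n)" "complex_of_real (c + 1) = of_nat (Suc (Suc n))"
      by (simp_all add: c_def)
    have "F (of_real (c + 1)) = (s - 1) * of_real (c + 1) powr (-s) + 2 * of_real (c + 1) powr (1 - s)"
      by (simp add: F_def)
    moreover have "F (of_real c) = - ((s - 1) * of_real c powr (-s)) + 2 * of_real c powr (1 - s)"
      by (simp add: F_def)
    ultimately have "F (of_real (c + 1)) - F (of_real c) = (s - 1) * (of_real c powr (-s) + of_real (c + 1) powr (-s))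
        + 2 * (of_real (c + 1) powr (1 - s) - of_real c powr (1 - s))"
      by (simp only:) (simp add: algebra_simps)
    moreover have "x + 2 * y = 2 * (x / 2 + y)" for x y :: complex by simp
    ultimately show ?thesis unfolding trapezoid_error_def c' by (simp only:)
  qed
  finally have *: "((\<lambda>x. (s - 1) * s * (s + 1) * (of_real ((x - c) * (c + 1 - x)) * of_real x powr (- s - 2))) has_integral 2 * trapezoid_error n s) (cbox c (c+1))"
    by simp
  have "norm (2 * trapezoid_error n s) \<le> norm ((s - 1) * s * (s + 1)) * c powr (- Re s - 2) * measure lborel (cbox c (c + 1))"
  proof (rule has_integral_bound[OF _ *])
    fix x assume "x \<in> cbox c (c + 1)"
    hence x: "c \<le> x" "x \<le> c + 1" by auto
    have "norm (complex_of_real ((x - c) * (c + 1 - x))) = (x - c) * (c + 1 - x)"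
      unfolding norm_of_real using x by simp
    also have "\<dots> \<le> 1 * 1" using x by (intro mult_mono) auto
    finally have 1: "norm (complex_of_real ((x - c) * (c + 1 - x))) \<le> 1" by simp
    have "norm (complex_of_real x powr (- s - 2)) = x powr (- Re s - 2)"
      using x c by (subst norm_powr_real_powr) auto
    also have "\<dots> \<le> c powr (- Re s - 2)" using x c assms by (intro powr_mono2') auto
    finally have 2: "norm (complex_of_real x powr (- s - 2)) \<le> c powr (- Re s - 2)" .
    show "norm ((s - 1) * s * (s + 1) * (of_real ((x - c) * (c + 1 - x)) * of_real x powr (- s - 2))) \<le> norm ((s - 1) * s * (s + 1)) * c powr (- Re s - 2)"
      unfolding norm_mult[of "(s - 1) * s * (s + 1)"] norm_mult[of "of_real ((x - c) * (c + 1 - x))"]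
      using mult_mono[OF 1 2] by (intro mult_left_mono) auto
  qed auto
  thus ?thesis by (simp add: norm_mult c_def)
qed

text \<open>\<open>(s - 1) \<zeta>(s)\<close> for \<open>Re s > -1\<close>, by the trapezoidal rule.\<close>

definition zeta_times :: "complex \<Rightarrow> complex" where
  "zeta_times s = 1 + (s - 1) / 2 + (\<Sum>n. trapezoid_error n s)"

text \<open>The cubic factor is bounded on the compact ball, and a radius of half the distance to
  the line \<open>Re s = -1\<close> keeps the exponent \<open>a\<close> below
  \<open>-1\<close>.\<close>

lemma trapezoid_error_locally_dominated:
  assumes "Re x > -1"
  shows "\<exists>d M. 0 < d \<and> cball x d \<subseteq> {s. Re s > -1} \<and> summable M \<and>
    (\<forall>n. \<forall>y\<in>cball x d. norm (trapezoid_error n y) \<le> M n)"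
proof -
  define d where "d = (Re x + 1) / 2"
  define a where "a = - ((Re x - 1) / 2) - 2"
  have y: "Re y \<ge> (Re x - 1) / 2" if "y \<in> cball x d" for y
    using cball_Re_ge[OF that] by (simp add: d_def field_simps)
  have "bounded ((\<lambda>s. (s - 1) * s * (s + 1)) ` cball x d)"
    by (intro compact_imp_bounded compact_continuous_image continuous_intros) auto
  then obtain K where "\<forall>w\<in>(\<lambda>s. (s - 1) * s * (s + 1)) ` cball x d. norm w \<le> K"
    unfolding bounded_iff by (elim exE)
  hence K: "norm ((y - 1) * y * (y + 1)) \<le> K" if "y \<in> cball x d" for y
    using that by blast
  have "norm (trapezoid_error n y) \<le> K / 2 * real (Suc n) powr a" if "y \<in> cball x d" for n y
  proof -
    have "norm (trapezoid_error n y) \<le> norm ((y - 1) * y * (y + 1)) / 2 * real (Suc n) powr (- Re y - 2)"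
      by (rule norm_trapezoid_error_le) (use y[OF that] assms in \<open>simp add: field_simps\<close>)
    also have "\<dots> \<le> K / 2 * real (Suc n) powr a"
      using K[OF that] y[OF that] order_trans[OF norm_ge_zero K[OF that]]
      by (intro mult_mono powr_mono divide_right_mono) (auto simp: a_def)
    finally show ?thesis .
  qed
  moreover have "cball x d \<subseteq> {s. Re s > -1}" using y assms by force
  moreover have "summable (\<lambda>n. K / 2 * real (Suc n) powr a)"
    using assms by (intro summable_mult summable_Suc_powr) (auto simp: a_def)
  ultimately show ?thesis using assms
    by (intro exI[of _ d] exI[of _ "\<lambda>n. K / 2 * real (Suc n) powr a"]) (auto simp: d_def)
qed

lemma holomorphic_zeta_times: "zeta_times holomorphic_on {s. Re s > -1}"
proof -
  have "(\<lambda>s. \<Sum>n. trapezoid_error n s) holomorphic_on {s. Re s > -1}"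
  proof (rule holomorphic_on_suminf_locally_dominated)
    show "trapezoid_error n holomorphic_on {s. Re s > -1}" for n
      unfolding trapezoid_error_def by (intro holomorphic_intros) auto
    show "\<exists>d M. 0 < d \<and> cball x d \<subseteq> {s. Re s > -1} \<and> summable M \<and>
        (\<forall>n. \<forall>y\<in>cball x d. norm (trapezoid_error n y) \<le> M n)" if "x \<in> {s. Re s > -1}" for x
      by (rule trapezoid_error_locally_dominated) (use that in simp)
  qed (rule open_halfspace_Re_gt)
  thus ?thesis unfolding zeta_times_def by (intro holomorphic_intros) auto
qed

lemma zeta_times_eq_zeta_series:
  assumes s: "Re s > 1"
  shows "zeta_times s = (s - 1) * zeta_series s"
proof -
  \<comment> \<open>Neighbouring trapezoids share an endpoint, so only the first and the last power
    count half, and the differences of powers with exponent \<open>1 - s\<close> telescope.\<close>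
  have partial: "(\<Sum>n<N. trapezoid_error n s) = (s - 1) * ((\<Sum>n<Suc N. of_nat (Suc n) powr (-s)) - (1 + of_nat (Suc N) powr (-s)) / 2)
      + of_nat (Suc N) powr (1 - s) - 1" for N
  proof (induction N)
    case (Suc N)
    have "(s - 1) * (S - (1 + a) / 2) + p - 1 + ((s - 1) * (a + b) / 2 + (q - p)) = (s - 1) * (S + b - (1 + b) / 2) + q - 1"
      for S a b p q by (simp add: field_simps)
    thus ?case
      unfolding sum.lessThan_Suc[of "\<lambda>n. trapezoid_error n s" N] Suc.IH
        sum.lessThan_Suc[of "\<lambda>n. of_nat (Suc n) powr (-s)" "Suc N"]
      unfolding trapezoid_error_def .
  qed simp
  have tend: "(\<lambda>N. of_nat (Suc N) powr z :: complex) \<longlonglongrightarrow> 0" if "Re z < 0" for z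
  proof -
    have "(\<lambda>N. real N powr Re z) \<longlonglongrightarrow> 0"
      using that by (intro tendsto_neg_powr filterlim_real_sequentially)
    hence "(\<lambda>N. real (Suc N) powr Re z) \<longlonglongrightarrow> 0"
      by (rule LIMSEQ_Suc)
    thus ?thesis unfolding norm_of_nat_Suc_powr[symmetric] by (rule tendsto_norm_zero_cancel)
  qed
  have "(\<lambda>N. \<Sum>n<N. of_nat (Suc n) powr (-s)) \<longlonglongrightarrow> zeta_series s"
    unfolding zeta_series_def using summable_LIMSEQ[OF summable_zeta_series[OF s]] .
  hence "(\<lambda>N. \<Sum>n<Suc N. of_nat (Suc n) powr (-s)) \<longlonglongrightarrow> zeta_series s"
    by (rule LIMSEQ_Suc)
  hence "(\<lambda>N. \<Sum>n<N. trapezoid_error n s) \<longlonglongrightarrow> (s - 1) * (zeta_series s - (1 + 0) / 2) + 0 - 1"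
    unfolding partial using s by (intro tendsto_intros tend) auto
  hence "(\<Sum>n. trapezoid_error n s) = (s - 1) * (zeta_series s - (1 + 0) / 2) + 0 - 1"
    by (simp add: sums_def sums_unique[symmetric])
  thus ?thesis by (simp add: zeta_times_def field_simps)
qed

text \<open>The right-hand side of Riemann's functional equation for \<open>zeta(s)\<close>; for
  \<open>Re s < 0\<close> the series at \<open>1 - s\<close> converges.\<close>

definition zeta_reflected :: "complex \<Rightarrow> complex" where
  "zeta_reflected s = 2 * of_real (2 * pi) powr (s - 1) * sin (of_real pi * s / 2) * Gamma (1 - s) * zeta_series (1 - s)"

lemma holomorphic_zeta_reflected: "zeta_reflected holomorphic_on {s. Re s < 0}"
proof -
  have "(\<lambda>s. zeta_series (1 - s)) holomorphic_on {s. Re s < 0}"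
    by (rule holomorphic_on_compose_gen[OF _ holomorphic_zeta_series, unfolded o_def])
       (auto intro!: holomorphic_intros)
  thus ?thesis unfolding zeta_reflected_def
    by (intro holomorphic_intros) (auto elim!: nonpos_Ints_cases simp: complex_eq_iff)
qed

lemma zeta_functional_equation_real:
  fixes s :: real
  assumes s: "-1 < s" "s < 0"
  shows "zeta_times (of_real s) = (of_real s - 1) * zeta_reflected (of_real s)"
proof -
  define u where "u = (\<lambda>n::nat. (s - 1) * (real n powr (-s) + (real n + 1) powr (-s)) / 2 + ((real n + 1) powr (1 - s) - real n powr (1 - s)))"
  define R where "R = (s - 1) * (2 * (2 * pi) powr (s - 1) * sin (pi * s / 2) * Gamma (1 - s) * (\<Sum>m. real (Suc m) powr (s - 1)))"
  have "u sums R" unfolding u_def R_def by (rule trapezoid_sums[OF s])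
  \<comment> \<open>\<open>trapezoid_error\<close> starts at the interval \<open>[1, 2]\<close>. The
    term removed here, for \<open>[0, 1]\<close>, is \<open>(s - 1) / 2 + 1\<close>, the explicit
    part of \<open>zeta_times\<close>.\<close>
  hence "(\<lambda>n. u (Suc n)) sums (R - u 0)" by (subst sums_Suc_iff) simp
  hence "(\<lambda>n. complex_of_real (u (Suc n))) sums of_real (R - u 0)" by (subst sums_of_real_iff)
  also have "(\<lambda>n. complex_of_real (u (Suc n))) = (\<lambda>n. trapezoid_error n (of_real s))"
  proof
    fix n
    have [simp]: "complex_of_nat m powr of_real x = of_real (real m powr x)" for m x
      using powr_of_real[of "real m" x] by simp
    have [simp]: "complex_of_nat m powr - of_real x = of_real (real m powr (-x))"
                 "complex_of_nat m powr (1 - of_real x) = of_real (real m powr (1-x))" for m x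
      using powr_of_real[of "real m" "-x"] powr_of_real[of "real m" "1-x"] by simp_all
    have Suc2: "real (Suc n) + 1 = real (Suc (Suc n))" by simp
    show "complex_of_real (u (Suc n)) = trapezoid_error n (of_real s)"
      unfolding trapezoid_error_def u_def Suc2 by (simp del: of_nat_Suc)
  qed
  finally have 1: "(\<Sum>n. trapezoid_error n (of_real s)) = of_real (R - u 0)" by (simp add: sums_iff)
  have u0: "u 0 = (s - 1) / 2 + 1" by (simp add: u_def)
  have "zeta_times (of_real s) = of_real R"
    unfolding zeta_times_def 1 u0 by simp
  moreover have "zeta_series (1 - of_real s) = of_real (\<Sum>m. real (Suc m) powr (s - 1))"
  proof -
    have "complex_of_nat m powr - (1 - of_real s) = of_real (real m powr (s - 1))" for m
      using powr_of_real[of "real m" "s - 1"] by simp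
    thus ?thesis unfolding zeta_series_def
      using s by (simp add: suminf_of_real[OF summable_Suc_powr] del: of_nat_Suc)
  qed
  moreover have "complex_of_real (2 * pi) powr (of_real s - 1) = of_real ((2 * pi) powr (s - 1))"
    using powr_of_real[of "2 * pi" "s - 1"] by simp
  moreover have "sin (of_real pi * of_real s / 2) = complex_of_real (sin (pi * s / 2))"
    by (simp add: sin_of_real[symmetric])
  moreover have "Gamma (1 - of_real s) = complex_of_real (Gamma (1 - s))"
    by (simp add: Gamma_complex_of_real[symmetric])
  ultimately show ?thesis unfolding zeta_reflected_def R_def by (simp del: of_nat_Suc)
qed

text \<open>Identity theorem: both sides are holomorphic on the vertical strip and agree on its real
  segment, which accumulates at \<open>-1/2\<close>.\<close>

lemma zeta_functional_equation:
  assumes s: "-1 < Re s" "Re s < 0"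
  shows "zeta_times s = (s - 1) * zeta_reflected s"
proof -
  let ?S = "{s. -1 < Re s} \<inter> {s. Re s < 0}"
  have "zeta_times s - (s - 1) * zeta_reflected s = 0"
  proof (rule analytic_continuation[where f = "\<lambda>s. zeta_times s - (s - 1) * zeta_reflected s" and w = s and S = ?S and U = "of_real ` {-1<..<0::real}" and \<xi> = "of_real (-1/2)"])
    show "(\<lambda>s. zeta_times s - (s - 1) * zeta_reflected s) holomorphic_on ?S"
      by (intro holomorphic_intros holomorphic_on_subset[OF holomorphic_zeta_times] holomorphic_on_subset[OF holomorphic_zeta_reflected]) auto
    show "open ?S" by (intro open_Int open_halfspace_Re_gt open_halfspace_Re_lt)
    show "connected ?S" by (intro convex_connected convex_Int convex_halfspace_Re_gt convex_halfspace_Re_lt)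
    show "complex_of_real (-1/2) islimpt of_real ` {-1<..<0}"
    proof -
      have "(-1/2::real) islimpt {-1<..<0}" by (rule interior_limit_point) (auto simp: interior_open)
      thus ?thesis
        by (rule islimpt_isCont_image)
           (simp_all only: of_real_eq_iff eventually_neq_at_within isCont_of_real continuous_ident)
    qed
  qed (use s zeta_functional_equation_real in auto)
  thus ?thesis by simp
qed

text \<open>By the functional equation the two formulas agree on the strip
  \<open>-1 < Re s < 0\<close>. This overlap makes the glued function meromorphic across the line
  \<open>Re s = -1\<close>.\<close>

definition zeta_cont :: "complex \<Rightarrow> complex" where
  "zeta_cont s = (if Re s > -1 then zeta_times s / (s - 1) else zeta_reflected s)"

lemma zeta_cont_right: "Re s > 1 \<Longrightarrow> zeta_cont s = zeta_series s"
  by (auto simp: zeta_cont_def zeta_times_eq_zeta_series)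

lemma zeta_cont_left: "Re s < 0 \<Longrightarrow> zeta_cont s = zeta_reflected s"
  by (auto simp: zeta_cont_def zeta_functional_equation)

lemma meromorphic_zeta_cont: "zeta_cont meromorphic_on UNIV"
proof -
  have "zeta_cont meromorphic_on {s. Re s < 0}"
  proof (subst meromorphic_on_cong)
    show "\<forall>\<^sub>F w in at z. zeta_cont w = zeta_reflected w" if "z \<in> {s. Re s < 0}" for z
      by (rule eventually_mono[OF eventually_at_in_open'[OF open_halfspace_Re_lt that]]) (simp add: zeta_cont_left)
    show "zeta_reflected meromorphic_on {s. Re s < 0}"
      using holomorphic_zeta_reflected
      by (intro analytic_on_imp_meromorphic_on) (simp add: analytic_on_open open_halfspace_Re_lt)
  qed auto
  moreover have "zeta_cont meromorphic_on {s. Re s > -1}"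
  proof (subst meromorphic_on_cong)
    show "\<forall>\<^sub>F w in at z. zeta_cont w = zeta_times w / (w - 1)" if "z \<in> {s. Re s > -1}" for z
      by (rule eventually_mono[OF eventually_at_in_open'[OF open_halfspace_Re_gt that]]) (simp add: zeta_cont_def)
    have "zeta_times meromorphic_on {s. Re s > -1}"
      using holomorphic_zeta_times
      by (intro analytic_on_imp_meromorphic_on) (simp add: analytic_on_open open_halfspace_Re_gt)
    thus "(\<lambda>w. zeta_times w / (w - 1)) meromorphic_on {s. Re s > -1}"
      by (intro meromorphic_intros)
  qed auto
  ultimately have "zeta_cont meromorphic_on ({s. Re s < 0} \<union> {s. Re s > -1})"
    by (rule meromorphic_on_Un)
  also have "{s. Re s < 0} \<union> {s. Re s > -1} = UNIV" by auto
  finally show ?thesis .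
qed

section \<open>The completed L-function of the Eisenstein series\<close>

text \<open>Only the punctured disc is given, because \<open>q = exp (2 * pi * i * \<tau>)\<close>
  never vanishes. The constant coefficient is the limit at 0; a further nonzero coefficient would
  make the zero at 0 isolated, whereas the sum vanishes throughout.\<close>

lemma powser_coeffs_eq_0:
  fixes d :: "nat \<Rightarrow> complex"
  assumes *: "\<And>q. 0 < norm q \<Longrightarrow> norm q < 1 \<Longrightarrow> (\<lambda>n. d n * q ^ n) sums 0"
  shows "d n = 0"
proof -
  define f where "f = (\<lambda>q::complex. if q = 0 then d 0 else 0 :: complex)"
  have f: "(\<lambda>n. d n * q ^ n) sums f q" if "norm q < 1" for q
    using *[of q] that by (cases "q = 0") (auto simp: f_def powser_sums_zero)
  have "(f \<longlongrightarrow> d 0) (at 0)" by (rule powser_limit_0[OF zero_less_one f])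
  moreover have "(f \<longlongrightarrow> 0) (at 0)"
    by (rule tendsto_eventually) (auto simp: f_def eventually_at_filter)
  ultimately have d0: "d 0 = 0" by (rule tendsto_unique[OF at_neq_bot])
  show ?thesis
  proof (rule ccontr)
    assume dn: "d n \<noteq> 0"
    hence n: "n > 0" using d0 by (cases n) auto
    have f0: "f 0 = 0" by (simp add: f_def d0)
    have f': "(\<lambda>n. d n * (q - 0) ^ n) sums f q" if "norm (q - 0) < 1" for q
      using f[of q] that by simp
    obtain s where s: "0 < s" "\<And>z. z \<in> cball 0 s - {0} \<Longrightarrow> f z \<noteq> 0"
      using powser_0_nonzero[OF zero_less_one f' f0 dn n] by metis
    from s(2)[of "of_real s"] s(1) show False by (simp add: f_def)
  qed
qed

section \<open>Fourier coefficients of the Eisenstein series\<close>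

lemma exp_2pi_i_nat_mult: "exp (2 * of_real pi * \<i> * of_nat n * \<tau>) = exp (2 * of_real pi * \<i> * \<tau>) ^ n"
  by (simp add: exp_of_nat_mult[symmetric] mult_ac)

text \<open>Uniqueness evaluates the definite description in \<open>fourier_coeff\<close>. It
  reduces to power series in \<open>q\<close>, as the upper half-plane covers the punctured unit
  disc.\<close>

lemma fourier_coeff_eqI:
  assumes a: "\<And>\<tau>. Im \<tau> > 0 \<Longrightarrow> (\<lambda>n. a n * exp (2 * of_real pi * \<i> * of_nat n * \<tau>)) sums f \<tau>"
  shows "fourier_coeff f = a"
  unfolding fourier_coeff_def
proof (rule the_equality)
  show "\<forall>\<tau>. Im \<tau> > 0 \<longrightarrow> (\<lambda>n. a n * exp (2 * of_real pi * \<i> * of_nat n * \<tau>)) sums f \<tau>"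
    using a by blast
next
  fix b assume b: "\<forall>\<tau>. Im \<tau> > 0 \<longrightarrow> (\<lambda>n. b n * exp (2 * of_real pi * \<i> * of_nat n * \<tau>)) sums f \<tau>"
  have "(\<lambda>n. (b n - a n) * q ^ n) sums 0" if q: "0 < norm q" "norm q < 1" for q
  proof -
    \<comment> \<open>A preimage of \<open>q\<close>; its imaginary part
      \<open>- ln (norm q) / (2 * pi)\<close> is positive because \<open>norm q < 1\<close>.\<close>
    define \<tau> where "\<tau> = Ln q / (2 * of_real pi * \<i>)"
    have "\<tau> = - \<i> * Ln q / of_real (2 * pi)" by (simp add: \<tau>_def field_simps)
    hence "Im \<tau> = - Re (Ln q) / (2 * pi)" by (simp only: Im_divide_of_real) simp
    moreover have "ln (norm q) < 0" using q by simp
    ultimately have Im: "Im \<tau> > 0" using q divide_neg_pos[of "ln (norm q)" "2 * pi"] by (simp add: Re_Ln)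
    have "exp (2 * of_real pi * \<i> * \<tau>) = q" using q by (simp add: \<tau>_def)
    hence "(\<lambda>n. b n * q ^ n) sums f \<tau>" "(\<lambda>n. a n * q ^ n) sums f \<tau>"
      using a[OF Im] b Im unfolding exp_2pi_i_nat_mult by auto
    from sums_diff[OF this] show ?thesis by (simp add: algebra_simps)
  qed
  hence "b n - a n = 0" for n by (rule powser_coeffs_eq_0)
  thus "b = a" by (auto simp: fun_eq_iff)
qed

lemma divisor_sigma_le: "n > 0 \<Longrightarrow> divisor_sigma j n \<le> n ^ Suc j"
proof -
  assume n: "n > 0"
  have "divisor_sigma j n \<le> (\<Sum>d\<in>{1..n}. n ^ j)"
    unfolding divisor_sigma_def using n
    by (intro order_trans[OF sum_mono sum_mono2] power_mono) (auto dest: dvd_imp_le intro!: Nat.gr0I)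
  thus ?thesis by simp
qed

lemma fourier_coeff_eisenstein:
  "fourier_coeff (eisenstein k) = (\<lambda>n. if n = 0 then 1 else
     of_real ((2 * pi) ^ k / (zeta (real k) * Gamma (real k))) * of_nat (divisor_sigma (k - 1) n))"
proof (rule fourier_coeff_eqI)
  fix \<tau> :: complex assume \<tau>: "Im \<tau> > 0"
  define c where "c = complex_of_real ((2 * pi) ^ k / (zeta (real k) * Gamma (real k)))"
  define q where "q = exp (2 * of_real pi * \<i> * \<tau>)"
  have q: "norm q < 1" using \<tau> by (simp add: q_def)
  \<comment> \<open>By \<open>divisor_sigma_le\<close> the series is dominated by that of
    \<open>n ^ Suc (k - 1) * q ^ n\<close>, whose radius of convergence is 1.\<close>
  have "summable (\<lambda>n. of_nat (divisor_sigma (k - 1) (Suc n)) * q ^ Suc n)"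
  proof (rule summable_comparison_test')
    have "summable (\<lambda>n. norm (of_nat n ^ Suc (k - 1) * q ^ n))"
    proof (rule abs_summable_in_conv_radius)
      have "conv_radius (\<lambda>n. of_nat n ^ Suc (k - 1) :: complex) = 1"
      proof (rule conv_radius_ratio_limit_nonzero[of _ 1])
        have "(\<lambda>n. (of_nat n / of_nat (Suc n)) ^ Suc (k - 1)) \<longlonglongrightarrow> (1 :: real) ^ Suc (k - 1)"
          by (intro tendsto_power LIMSEQ_n_over_Suc_n)
        thus "(\<lambda>n. norm (of_nat n ^ Suc (k - 1) :: complex) / norm (of_nat (Suc n) ^ Suc (k - 1) :: complex)) \<longlonglongrightarrow> 1"
          unfolding norm_power norm_of_nat power_divide[symmetric] by simp
      qed (simp_all add: one_ereal_def)
      thus "ereal (norm q) < conv_radius (\<lambda>n. of_nat n ^ Suc (k - 1) :: complex)"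
        using q by (simp add: one_ereal_def)
    qed
    thus "summable (\<lambda>n. norm (of_nat (Suc n) ^ Suc (k - 1) * q ^ Suc n))"
      by (subst summable_Suc_iff)
    show "norm (of_nat (divisor_sigma (k - 1) (Suc n)) * q ^ Suc n) \<le> norm (of_nat (Suc n) ^ Suc (k - 1) * q ^ Suc n)" for n
      unfolding norm_mult norm_power norm_of_nat
      using divisor_sigma_le[of "Suc n" "k - 1"]
      by (intro mult_right_mono) (auto simp del: power_Suc of_nat_Suc simp flip: of_nat_power)
  qed
  hence "(\<lambda>n. c * (of_nat (divisor_sigma (k - 1) (Suc n)) * q ^ Suc n)) sums (c * (\<Sum>n. of_nat (divisor_sigma (k - 1) (Suc n)) * q ^ Suc n))"
    by (intro sums_mult summable_sums)
  hence "(\<lambda>n. (if Suc n = 0 then 1 else c * of_nat (divisor_sigma (k - 1) (Suc n))) * q ^ Suc n) sums (eisenstein k \<tau> - 1)"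
    unfolding eisenstein_def exp_2pi_i_nat_mult q_def[symmetric] c_def[symmetric] by (simp add: mult.assoc)
  hence "(\<lambda>n. (if n = 0 then 1 else c * of_nat (divisor_sigma (k - 1) n)) * q ^ n) sums eisenstein k \<tau>"
    by (subst (asm) sums_Suc_iff) simp
  thus "(\<lambda>n. (if n = 0 then 1 else c * of_nat (divisor_sigma (k - 1) n)) * exp (2 * of_real pi * \<i> * of_nat n * \<tau>)) sums eisenstein k \<tau>"
    unfolding exp_2pi_i_nat_mult q_def .
qed

text \<open>The two absolutely convergent Dirichlet series are multiplied, and the pairs
  \<open>(a, b)\<close> are collected by their product; the factor \<open>a\<close>, as a divisor
  \<open>d\<close> of the product, carries the weight \<open>d ^ j\<close>.\<close>

lemma dirichlet_series_divisor_sigma: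
  assumes s: "Re s > real j + 1"
  shows "(\<lambda>n. of_nat (divisor_sigma j (Suc n)) * of_nat (Suc n) powr (-s)) sums (zeta_series s * zeta_series (s - of_nat j))"
proof -
  define u where "u = (\<lambda>i. of_nat (Suc i) powr (-(s - of_nat j)) :: complex)"
  define v where "v = (\<lambda>i. of_nat (Suc i) powr (-s) :: complex)"
  have nu: "summable (\<lambda>i. norm (u i))" and nv: "summable (\<lambda>i. norm (v i))"
    unfolding u_def v_def norm_of_nat_Suc_powr by (intro summable_Suc_powr; use s in simp)+
  have u: "(u has_sum zeta_series (s - of_nat j)) UNIV" and v: "(v has_sum zeta_series s) UNIV"
    by (rule norm_summable_imp_has_sum; use nu nv s in \<open>simp add: u_def v_def zeta_series_def summable_sums summable_norm_cancel\<close>)+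
  have "(\<lambda>p. norm (u (fst p) * v (snd p))) summable_on (UNIV \<times> UNIV)"
    unfolding Infinite_Sum.abs_summable_on_Sigma_iff
  proof (intro conjI ballI)
    have nv': "(\<lambda>i. norm (v i)) summable_on UNIV" and nu': "(\<lambda>i. norm (u i)) summable_on UNIV"
      by (intro summable_nonneg_imp_summable_on nu nv; simp)+
    show "(\<lambda>y. norm (u (fst (x, y)) * v (snd (x, y)))) summable_on UNIV" for x
      using nv' by (simp add: norm_mult summable_on_cmult_right)
    have "(\<lambda>x. norm (u x) * (\<Sum>\<^sub>\<infinity>y. norm (v y))) summable_on UNIV"
      using nu' by (rule summable_on_cmult_left)
    thus "(\<lambda>x. norm (\<Sum>\<^sub>\<infinity>y. norm (u (fst (x, y)) * v (snd (x, y))))) summable_on UNIV"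
      by (simp add: norm_mult infsum_cmult_right' infsum_nonneg)
  qed
  hence "(\<lambda>p. u (fst p) * v (snd p)) summable_on (UNIV \<times> UNIV)"
    by (rule Infinite_Sum.abs_summable_summable)
  hence "((\<lambda>p. u (fst p) * v (snd p)) has_sum (zeta_series (s - of_nat j) * zeta_series s)) (UNIV \<times> UNIV)"
    by (intro has_sum_SigmaI[where g = "\<lambda>x. u x * zeta_series s"] has_sum_cmult_left[OF u])
       (simp_all add: has_sum_cmult_right[OF v])
  also have "?this \<longleftrightarrow> ((\<lambda>(n, d). of_nat d ^ j * of_nat (Suc n) powr (-s)) has_sum (zeta_series s * zeta_series (s - of_nat j)))
      (SIGMA n:UNIV. {d. d dvd Suc n})"
  \<comment> \<open>The indices \<open>a\<close>, \<open>b\<close> and \<open>n\<close> stand for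
    their successors, while \<open>d\<close> is the divisor itself.\<close>
  proof (rule has_sum_reindex_bij_witness[where i = "\<lambda>(n, d). (d - 1, Suc n div d - 1)" and j = "\<lambda>(a, b). (Suc a * Suc b - 1, Suc a)"])
    fix p :: "nat \<times> nat" assume "p \<in> UNIV \<times> UNIV"
    obtain a b where p: "p = (a, b)" by (cases p)
    show "(case case p of (a, b) \<Rightarrow> (Suc a * Suc b - 1, Suc a) of (n, d) \<Rightarrow> (d - 1, Suc n div d - 1)) = p"
      by (simp add: p del: mult_Suc mult_Suc_right)
    show "(case p of (a, b) \<Rightarrow> (Suc a * Suc b - 1, Suc a)) \<in> (SIGMA n:UNIV. {d. d dvd Suc n})"
      by (simp add: p del: mult_Suc mult_Suc_right)
    have "(of_nat (Suc a) * of_nat (Suc b)) powr (-s) = of_nat (Suc a) powr (-s) * (of_nat (Suc b) powr (-s) :: complex)"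
      using powr_times_real[of "of_nat (Suc a)" "of_nat (Suc b)" "-s"] by simp
    moreover have "of_nat (Suc a) powr (- (s - of_nat j)) = of_nat (Suc a) ^ j * (of_nat (Suc a) powr (-s) :: complex)"
      using powr_add[of "of_nat (Suc a)" "-s" "of_nat j :: complex"] powr_nat'[of "of_nat (Suc a) :: complex" j]
      by (simp add: algebra_simps del: of_nat_Suc)
    ultimately show "(case case p of (a, b) \<Rightarrow> (Suc a * Suc b - 1, Suc a) of (n, d) \<Rightarrow> of_nat d ^ j * of_nat (Suc n) powr (-s)) = u (fst p) * v (snd p)"
      by (simp add: p u_def v_def del: mult_Suc mult_Suc_right of_nat_Suc)
  next
    fix p :: "nat \<times> nat" assume "p \<in> (SIGMA n:UNIV. {d. d dvd Suc n})"
    then obtain n d where p: "p = (n, d)" and d: "d dvd Suc n" by (cases p) auto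
    then obtain m where m: "Suc n = d * m" by auto
    hence "d > 0" "m > 0" by (auto intro!: Nat.gr0I)
    thus "(case case p of (n, d) \<Rightarrow> (d - 1, Suc n div d - 1) of (a, b) \<Rightarrow> (Suc a * Suc b - 1, Suc a)) = p"
      using m by (simp add: p del: mult_Suc mult_Suc_right)
    show "(case p of (n, d) \<Rightarrow> (d - 1, Suc n div d - 1)) \<in> UNIV \<times> UNIV" by auto
  qed (simp add: mult.commute)
  finally have "((\<lambda>n. of_nat (divisor_sigma j (Suc n)) * of_nat (Suc n) powr (-s)) has_sum (zeta_series s * zeta_series (s - of_nat j))) UNIV"
  proof (rule has_sum_SigmaD)
    fix n :: nat
    have fin: "finite {d. d dvd Suc n}" by simp
    have "of_nat (divisor_sigma j (Suc n)) * of_nat (Suc n) powr (-s) = (\<Sum>d | d dvd Suc n. of_nat d ^ j * of_nat (Suc n) powr (-s))"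
      by (simp add: divisor_sigma_def sum_distrib_right del: of_nat_Suc)
    thus "((\<lambda>y. case (n, y) of (n, d) \<Rightarrow> of_nat d ^ j * of_nat (Suc n) powr (-s)) has_sum
        of_nat (divisor_sigma j (Suc n)) * of_nat (Suc n) powr (-s)) {d. d dvd Suc n}"
      using has_sum_finite[OF fin] by (simp del: of_nat_Suc)
  qed
  thus ?thesis by (rule has_sum_imp_sums)
qed

text \<open>Identity theorem: the difference, with its removable singularities removed, vanishes on
  a half-plane and hence everywhere. Equality at each single point follows because a nicely
  meromorphic function is 0 at its poles and continuous elsewhere.\<close>

lemma nicely_meromorphic_eqI:
  assumes g: "g nicely_meromorphic_on UNIV" and h: "h nicely_meromorphic_on UNIV"
    and eq: "\<And>s. Re s > c \<Longrightarrow> g s = h s"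
  shows "g = h"
proof
  fix z :: complex
  define r where "r = remove_sings (\<lambda>s. g s - h s)"
  have gh: "(\<lambda>s. g s - h s) meromorphic_on UNIV"
    using g h unfolding nicely_meromorphic_on_def by (intro meromorphic_intros) auto
  have r: "r nicely_meromorphic_on UNIV" unfolding r_def by (rule remove_sings_nicely_meromorphic[OF gh])
  have r0: "r s = 0" if "Re s > c" for s
  proof -
    have "eventually (\<lambda>w. w \<in> {w. Re w > c}) (at s)"
      by (rule eventually_at_in_open'[OF open_halfspace_Re_gt]) (use that in simp)
    hence "((\<lambda>s. g s - h s) \<longlongrightarrow> 0) (at s)"
      by (intro tendsto_eventually) (auto elim!: eventually_mono simp: eq)
    thus ?thesis unfolding r_def by (rule remove_sings_eqI)
  qed
  have "r constant_on UNIV"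
  proof (rule constant_on_extend_nicely_meromorphic_on[OF r])
    show "r constant_on {s. Re s > c}" using r0 by (auto simp: constant_on_def)
    have "complex_of_real (c + 1) \<in> {s. Re s > c}" by simp
    thus "{s. Re s > c} \<noteq> {}" by blast
  qed (auto simp: open_halfspace_Re_gt)
  moreover have "r (of_real (c + 1)) = 0" by (rule r0) simp
  ultimately have r0: "r s = 0" for s by (metis UNIV_I constant_on_def)
  have "eventually (\<lambda>w. r w = g w - h w) (at z)"
    unfolding r_def using gh by (intro eventually_remove_sings_eq_at) (auto simp: meromorphic_on_altdef)
  hence ev: "eventually (\<lambda>w. g w = h w) (at z)" by (auto elim!: eventually_mono simp: r0)
  show "g z = h z"
  proof (cases "is_pole g z")
    case True
    moreover have "is_pole h z" using True is_pole_cong[OF ev refl] by simp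
    ultimately show ?thesis using g h not_tendsto_and_filterlim_at_infinity[OF at_neq_bot]
      unfolding nicely_meromorphic_on_def is_pole_def by (metis UNIV_I)
  next
    case False
    hence "\<not> is_pole h z" using is_pole_cong[OF ev refl] by simp
    with False g h have "(g \<longlongrightarrow> g z) (at z)" "(h \<longlongrightarrow> h z) (at z)"
      unfolding nicely_meromorphic_on_def by blast+
    moreover have "(g \<longlongrightarrow> h z) (at z)"
      using \<open>(h \<longlongrightarrow> h z) (at z)\<close> by (rule tendsto_cong[OF ev, THEN iffD2])
    ultimately show ?thesis using tendsto_unique[OF at_neq_bot] by blast
  qed
qed

lemma completed_L_eqI:
  assumes g: "g nicely_meromorphic_on UNIV"
    and eq: "\<And>s. Re s > c \<Longrightarrow> summable (L_term f s) \<and> g s = of_real (2 * pi) powr (-s) * Gamma s * L_series f s"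
  shows "completed_L f = g"
  unfolding completed_L_def
proof (rule the_equality)
  fix h assume h: "h nicely_meromorphic_on UNIV \<and> (\<exists>c::real. \<forall>s. Re s > c \<longrightarrow>
       summable (L_term f s) \<and> h s = of_real (2 * pi) powr (-s) * Gamma s * L_series f s)"
  then obtain c' where "\<And>s. Re s > c' \<Longrightarrow> h s = of_real (2 * pi) powr (-s) * Gamma s * L_series f s" by blast
  \<comment> \<open>The competing function may be prescribed on another half-plane; the two are
    compared on the smaller one.\<close>
  thus "h = g" using h g eq by (intro nicely_meromorphic_eqI[where c = "max c c'"]) auto
qed (use assms in blast)

text \<open>For \<open>Re s > k\<close> the L-series is a constant times
  \<open>zeta(s) * zeta(s - k + 1)\<close>, and this product is meromorphic on the plane.
  \<open>remove_sings\<close> brings it into the normal form that \<open>completed_L\<close>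
  demands.\<close>

lemma completed_L_eisenstein:
  fixes k :: nat
  assumes k: "k \<ge> 2"
  shows "completed_L (eisenstein k) = remove_sings (\<lambda>s. of_real ((2 * pi) ^ k / (zeta (real k) * Gamma (real k))) *
     of_real (2 * pi) powr (-s) * Gamma s * (zeta_cont s * zeta_cont (s - of_nat k + 1)))"
proof -
  define c where "c = complex_of_real ((2 * pi) ^ k / (zeta (real k) * Gamma (real k)))"
  define g where "g = (\<lambda>s. c * of_real (2 * pi) powr (-s) * Gamma s * (zeta_cont s * zeta_cont (s - of_nat k + 1)))"
  have "(\<lambda>s. zeta_cont (s - of_nat k + 1)) meromorphic_on UNIV"
    by (rule meromorphic_on_compose[OF meromorphic_zeta_cont]) (auto intro!: analytic_intros)
  hence g: "g meromorphic_on UNIV"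
    \<comment> \<open>\<open>Gamma\<close> is opened to the reciprocal of \<open>rGamma\<close>,
      which is analytic everywhere.\<close>
    unfolding g_def Gamma_def
    by (intro meromorphic_intros meromorphic_zeta_cont analytic_on_imp_meromorphic_on[of "\<lambda>s. of_real (2 * pi) powr (-s)"]
          analytic_on_imp_meromorphic_on[OF analytic_rGamma])
       (auto intro!: analytic_intros simp: complex_nonpos_Reals_iff linorder_not_less[symmetric])
  have "completed_L (eisenstein k) = remove_sings g"
  proof (rule completed_L_eqI[where c = "real k"])
    show "remove_sings g nicely_meromorphic_on UNIV" by (rule remove_sings_nicely_meromorphic[OF g])
    fix s assume s: "Re s > real k"
    have *: "s - of_nat (k - 1) = s - of_nat k + 1" using k by (simp add: of_nat_diff)
    have "L_term (eisenstein k) s = (\<lambda>n. c * (of_nat (divisor_sigma (k - 1) (Suc n)) * of_nat (Suc n) powr (-s)))"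
      by (simp add: L_term_def fun_eq_iff fourier_coeff_eisenstein c_def mult.assoc)
    moreover have "\<dots> sums (c * (zeta_series s * zeta_series (s - of_nat k + 1)))"
      unfolding *[symmetric] using s k by (intro sums_mult dirichlet_series_divisor_sigma) (simp add: of_nat_diff)
    ultimately have L: "summable (L_term (eisenstein k) s)" "L_series (eisenstein k) s = c * (zeta_series s * zeta_series (s - of_nat k + 1))"
      by (auto simp: L_series_def sums_iff)
    \<comment> \<open>Analyticity on this half-plane ensures that \<open>remove_sings\<close> leaves
      the values of \<open>g\<close> there unchanged.\<close>
    have "g analytic_on {w. Re w > real k}"
    proof (subst analytic_on_open)
      have "(\<lambda>s. zeta_series (s - of_nat k + 1)) holomorphic_on {w. Re w > real k}"
        by (rule holomorphic_on_compose_gen[OF _ holomorphic_zeta_series, unfolded o_def])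
           (use k in \<open>auto intro!: holomorphic_intros\<close>)
      hence "(\<lambda>s. c * of_real (2 * pi) powr (-s) * Gamma s * (zeta_series s * zeta_series (s - of_nat k + 1))) holomorphic_on {w. Re w > real k}"
        using k by (intro holomorphic_intros holomorphic_on_subset[OF holomorphic_zeta_series]) (auto elim!: nonpos_Ints_cases)
      thus "g holomorphic_on {w. Re w > real k}"
        by (rule holomorphic_transform) (use k in \<open>auto simp: g_def zeta_cont_right\<close>)
    qed (rule open_halfspace_Re_gt)
    hence "g analytic_on {s}" by (rule analytic_on_subset) (use s in simp)
    thus "summable (L_term (eisenstein k) s) \<and> remove_sings g s = of_real (2 * pi) powr (-s) * Gamma s * L_series (eisenstein k) s"
      using s k L by (simp add: g_def zeta_cont_right)
  qed
  thus ?thesis by (simp add: g_def c_def)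
qed

section \<open>Monotonicity of the coefficients\<close>

text \<open>Zeta on \<open>x > 1\<close> as a real function. Taking the real part loses nothing
  there, by the second claim of \<open>zeta_real_LIMSEQ\<close>.\<close>

definition zeta_real :: "real \<Rightarrow> real" where
  "zeta_real x = Re (zeta_series (of_real x))"

definition zeta_real_deriv :: "real \<Rightarrow> real" where
  "zeta_real_deriv x = Re (deriv zeta_series (of_real x))"

lemma of_nat_powr_of_real: "complex_of_nat m powr (- of_real x) = of_real (real m powr (- x))"
  using powr_of_real[of "real m" "-x"] by simp

lemma zeta_real_LIMSEQ:
  assumes x: "x > 1"
  shows "(\<lambda>N. \<Sum>n<N. real (Suc n) powr (-x)) \<longlonglongrightarrow> zeta_real x"
    and "zeta_series (of_real x) = of_real (zeta_real x)"
proof -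
  have "(\<lambda>N. \<Sum>n<N. of_nat (Suc n) powr (- of_real x)) \<longlonglongrightarrow> zeta_series (of_real x)"
    unfolding zeta_series_def by (rule summable_LIMSEQ[OF summable_zeta_series]) (use x in simp)
  hence *: "(\<lambda>N. complex_of_real (\<Sum>n<N. real (Suc n) powr (-x))) \<longlonglongrightarrow> zeta_series (of_real x)"
    unfolding of_nat_powr_of_real of_real_sum .
  from tendsto_Re[OF *] show 1: "(\<lambda>N. \<Sum>n<N. real (Suc n) powr (-x)) \<longlonglongrightarrow> zeta_real x"
    unfolding zeta_real_def by (simp del: of_nat_Suc of_real_sum)
  show "zeta_series (of_real x) = of_real (zeta_real x)"
    by (rule LIMSEQ_unique[OF * tendsto_of_real[OF 1]])
qed

text \<open>Locally uniform convergence permits termwise differentiation. The limit is stated for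
  partial sums so that these can be multiplied out in \<open>zeta_pair_deriv_mono\<close>.\<close>

lemma zeta_real_deriv_LIMSEQ:
  assumes x: "x > 1"
  shows "(\<lambda>N. \<Sum>n<N. - ln (real (Suc n)) * real (Suc n) powr (-x)) \<longlonglongrightarrow> zeta_real_deriv x"
    and "(zeta_series has_field_derivative of_real (zeta_real_deriv x)) (at (of_real x))"
proof -
  let ?S = "{s. Re s > 1}"
  have "\<exists>g'. \<forall>s\<in>?S. (zeta_series has_field_derivative g' s) (at s) \<and>
      (\<lambda>N. \<Sum>n<N. - Ln (of_nat (Suc n)) * of_nat (Suc n) powr (-s)) \<longlonglongrightarrow> g' s"
  proof (rule has_complex_derivative_uniform_sequence)
    show "open ?S" by (rule open_halfspace_Re_gt)
    show "((\<lambda>s. \<Sum>n<N. of_nat (Suc n) powr (-s)) has_field_derivative (\<Sum>n<N. - Ln (of_nat (Suc n)) * of_nat (Suc n) powr (-s))) (at s)" for N s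
    proof (rule DERIV_sum)
      have "(of_nat (Suc n) :: complex) \<noteq> 0" for n by (simp del: of_nat_Suc)
      from DERIV_chain2[OF has_field_derivative_powr_right[OF this] DERIV_minus[OF DERIV_ident]]
      show "((\<lambda>s. of_nat (Suc n) powr (-s)) has_field_derivative - Ln (of_nat (Suc n)) * of_nat (Suc n) powr (-s)) (at s)" for n
        by simp
    qed
    show "\<exists>d>0. cball s d \<subseteq> ?S \<and> uniform_limit (cball s d) (\<lambda>N s. \<Sum>n<N. of_nat (Suc n) powr (-s)) zeta_series sequentially"
      if "s \<in> ?S" for s
    proof -
      have s: "Re s > 1" using that by simp
      obtain d M where d: "0 < d" "cball s d \<subseteq> ?S" and M: "summable M"
          "\<forall>n. \<forall>y\<in>cball s d. norm (of_nat (Suc n) powr (-y) :: complex) \<le> M n"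
        using zeta_series_locally_dominated[OF s] by (elim exE conjE)
      have "uniform_limit (cball s d) (\<lambda>N s. \<Sum>n<N. of_nat (Suc n) powr (-s)) zeta_series sequentially"
        unfolding zeta_series_def by (rule Weierstrass_m_test[OF _ M(1)]) (use M(2) in simp)
      with d show ?thesis by (intro exI[of _ d] conjI)
    qed
  qed
  then obtain g' where "\<forall>s\<in>?S. (zeta_series has_field_derivative g' s) (at s) \<and>
      (\<lambda>N. \<Sum>n<N. - Ln (of_nat (Suc n)) * of_nat (Suc n) powr (-s)) \<longlonglongrightarrow> g' s"
    by (elim exE)
  hence g': "\<And>s. Re s > 1 \<Longrightarrow> (zeta_series has_field_derivative g' s) (at s)"
    "\<And>s. Re s > 1 \<Longrightarrow> (\<lambda>N. \<Sum>n<N. - Ln (of_nat (Suc n)) * of_nat (Suc n) powr (-s)) \<longlonglongrightarrow> g' s"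
    by simp_all
  have deriv: "(zeta_series has_field_derivative g' (of_real x)) (at (of_real x))" by (rule g') (use x in simp)
  have "(\<lambda>N. \<Sum>n<N. - Ln (of_nat (Suc n)) * of_nat (Suc n) powr (- of_real x)) \<longlonglongrightarrow> g' (of_real x)"
    by (rule g') (use x in simp)
  moreover have "- Ln (of_nat (Suc n)) * of_nat (Suc n) powr (- of_real x) = complex_of_real (- ln (real (Suc n)) * real (Suc n) powr (-x))" for n
    using Ln_of_real[of "real (Suc n)"] unfolding of_nat_powr_of_real by simp
  ultimately have *: "(\<lambda>N. complex_of_real (\<Sum>n<N. - ln (real (Suc n)) * real (Suc n) powr (-x))) \<longlonglongrightarrow> g' (of_real x)"
    by (simp only: of_real_sum)
  have eq: "zeta_real_deriv x = Re (g' (of_real x))" using DERIV_imp_deriv[OF deriv] by (simp add: zeta_real_deriv_def)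
  from tendsto_Re[OF *] show 1: "(\<lambda>N. \<Sum>n<N. - ln (real (Suc n)) * real (Suc n) powr (-x)) \<longlonglongrightarrow> zeta_real_deriv x"
    unfolding eq by (simp only: Re_complex_of_real)
  have "g' (of_real x) = of_real (zeta_real_deriv x)"
    by (rule LIMSEQ_unique[OF * tendsto_of_real[OF 1]])
  with deriv show "(zeta_series has_field_derivative of_real (zeta_real_deriv x)) (at (of_real x))" by simp
qed

lemma has_real_derivative_zeta_real:
  assumes "x > 1"
  shows "(zeta_real has_real_derivative zeta_real_deriv x) (at x)"
proof -
  have "((\<lambda>y. zeta_series (of_real y)) has_vector_derivative of_real (zeta_real_deriv x)) (at x)"
    by (rule has_vector_derivative_real_field[OF zeta_real_deriv_LIMSEQ(2)[OF assms]])
  from bounded_linear.has_vector_derivative[OF bounded_linear_Re this]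
  show ?thesis unfolding zeta_real_def has_real_derivative_iff_has_vector_derivative by simp
qed

lemma zeta_real_pos: "x > 1 \<Longrightarrow> zeta_real x > 0"
proof -
  assume x: "x > 1"
  have "(\<lambda>n. real (Suc n) powr (-x)) sums zeta_real x"
    using zeta_real_LIMSEQ(1)[OF x] by (simp add: sums_def)
  thus ?thesis using suminf_pos[of "\<lambda>n. real (Suc n) powr (-x)"] by (simp add: sums_iff)
qed

text \<open>The derivative of \<open>\<zeta>(x) \<zeta>(\<kappa> - x)\<close>, that is, the double series over \<open>a, b \<ge> 1\<close> of
  \<open>ln(b/a) b\<^bsup>-\<kappa>\<^esup> (b/a)\<^bsup>x\<^esup>\<close>, each term of which increases with \<open>x\<close>.\<close>

definition zeta_pair_deriv :: "real \<Rightarrow> real \<Rightarrow> real" where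
  "zeta_pair_deriv \<kappa> x = zeta_real_deriv x * zeta_real (\<kappa> - x) - zeta_real x * zeta_real_deriv (\<kappa> - x)"

text \<open>Proved for the square truncations \<open>a, b < N\<close> and passed to the limit. Each
  term is a positive constant times \<open>L * exp (L * x)\<close> with
  \<open>L = ln (Suc b / Suc a)\<close>, which is nondecreasing in \<open>x\<close> for either sign
  of \<open>L\<close>.\<close>

lemma zeta_pair_deriv_mono:
  assumes "1 < x" "x \<le> y" "y < \<kappa> - 1"
  shows "zeta_pair_deriv \<kappa> x \<le> zeta_pair_deriv \<kappa> y"
proof -
  define D where "D = (\<lambda>N x. \<Sum>a<N. \<Sum>b<N. (ln (real (Suc b)) - ln (real (Suc a))) * (real (Suc a) powr (-x) * real (Suc b) powr (-(\<kappa> - x))))"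
  have lim: "(\<lambda>N. D N x) \<longlonglongrightarrow> zeta_pair_deriv \<kappa> x" if "1 < x" "x < \<kappa> - 1" for x
  proof -
    have "(\<lambda>N. (\<Sum>n<N. - ln (real (Suc n)) * real (Suc n) powr (-x)) * (\<Sum>n<N. real (Suc n) powr (-(\<kappa> - x)))
      - (\<Sum>n<N. real (Suc n) powr (-x)) * (\<Sum>n<N. - ln (real (Suc n)) * real (Suc n) powr (-(\<kappa> - x)))) \<longlonglongrightarrow> zeta_pair_deriv \<kappa> x"
      unfolding zeta_pair_deriv_def using that
      by (intro tendsto_intros zeta_real_LIMSEQ zeta_real_deriv_LIMSEQ) auto
    also have "(\<lambda>N. (\<Sum>n<N. - ln (real (Suc n)) * real (Suc n) powr (-x)) * (\<Sum>n<N. real (Suc n) powr (-(\<kappa> - x)))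
      - (\<Sum>n<N. real (Suc n) powr (-x)) * (\<Sum>n<N. - ln (real (Suc n)) * real (Suc n) powr (-(\<kappa> - x)))) = (\<lambda>N. D N x)"
      unfolding D_def sum_product sum_subtractf[symmetric]
      by (intro ext sum.cong refl) (simp add: algebra_simps del: of_nat_Suc)
    finally show ?thesis .
  qed
  have "D N x \<le> D N y" for N
    unfolding D_def
  proof (intro sum_mono)
    fix a b
    define L where "L = ln (real (Suc b)) - ln (real (Suc a))"
    have *: "real (Suc a) powr (-x) * real (Suc b) powr (-(\<kappa> - x)) = exp (- \<kappa> * ln (real (Suc b))) * exp (L * x)" for x
      by (simp add: powr_def L_def algebra_simps flip: exp_add del: of_nat_Suc)
    have "L * exp (L * x) \<le> L * exp (L * y)"
    proof (cases "L \<ge> 0")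
      case True
      thus ?thesis using assms by (intro mult_left_mono) (auto intro: mult_left_mono)
    next
      case False
      thus ?thesis using assms by (intro mult_left_mono_neg) (auto intro: mult_left_mono_neg)
    qed
    hence "exp (- \<kappa> * ln (real (Suc b))) * (L * exp (L * x)) \<le> exp (- \<kappa> * ln (real (Suc b))) * (L * exp (L * y))"
      by (rule mult_left_mono) simp
    thus "(ln (real (Suc b)) - ln (real (Suc a))) * (real (Suc a) powr (-x) * real (Suc b) powr (-(\<kappa> - x)))
       \<le> (ln (real (Suc b)) - ln (real (Suc a))) * (real (Suc a) powr (-y) * real (Suc b) powr (-(\<kappa> - y)))"
      unfolding * L_def[symmetric] by (simp only: mult_ac)
  qed
  thus ?thesis using assms by (intro LIMSEQ_le[OF lim lim]) auto
qed

text \<open>By antisymmetry the expression vanishes at \<open>\<kappa> / 2\<close>, and it is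
  nondecreasing from there on.\<close>

lemma zeta_pair_deriv_nonneg:
  assumes "\<kappa> > 2" "\<kappa> / 2 \<le> x" "x < \<kappa> - 1"
  shows "zeta_pair_deriv \<kappa> x \<ge> 0"
proof -
  have "zeta_pair_deriv \<kappa> (\<kappa> / 2) \<le> zeta_pair_deriv \<kappa> x"
    using assms by (intro zeta_pair_deriv_mono) auto
  moreover have "\<kappa> - \<kappa> / 2 = \<kappa> / 2" by simp
  ultimately show ?thesis by (simp add: zeta_pair_deriv_def)
qed

lemma zeta_pair_mono:
  assumes "\<kappa> > 2" "\<kappa> / 2 \<le> x" "x \<le> y" "y < \<kappa> - 1"
  shows "zeta_real x * zeta_real (\<kappa> - x) \<le> zeta_real y * zeta_real (\<kappa> - y)"
proof (rule DERIV_nonneg_imp_nondecreasing[OF assms(3)])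
  fix t assume t: "x \<le> t" "t \<le> y"
  have "((\<lambda>t. zeta_real t * zeta_real (\<kappa> - t)) has_real_derivative zeta_pair_deriv \<kappa> t) (at t)"
    unfolding zeta_pair_deriv_def using t assms
    by (auto intro!: derivative_eq_intros DERIV_chain2[OF has_real_derivative_zeta_real] has_real_derivative_zeta_real simp: algebra_simps)
  moreover have "zeta_pair_deriv \<kappa> t \<ge> 0" using t assms by (intro zeta_pair_deriv_nonneg) auto
  ultimately show "\<exists>D. ((\<lambda>t. zeta_real t * zeta_real (\<kappa> - t)) has_real_derivative D) (at t) \<and> 0 \<le> D" by blast
qed

text \<open>The derivative of \<open>Gamma x * Gamma (\<kappa> - x) * zeta_real x * zeta_real
  (\<kappa> - x)\<close> divided by its Gamma factors. It is what remains of the derivative of the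
  completed L-function at even integers after splitting off signs, constants and Gamma
  factors.\<close>

definition eisenstein_weight :: "real \<Rightarrow> real \<Rightarrow> real" where
  "eisenstein_weight \<kappa> x = zeta_real x * zeta_real (\<kappa> - x) * (Digamma x - Digamma (\<kappa> - x)) + zeta_pair_deriv \<kappa> x"

lemma eisenstein_weight_reflect: "eisenstein_weight \<kappa> (\<kappa> - x) = - eisenstein_weight \<kappa> x"
  by (simp add: eisenstein_weight_def zeta_pair_deriv_def algebra_simps)

text \<open>Right of the centre, the first summand is a product of nonnegative nondecreasing
  factors, and the second summand is nondecreasing.\<close>

lemma eisenstein_weight_mono:
  assumes "\<kappa> > 2" "\<kappa> / 2 \<le> x" "x \<le> y" "y < \<kappa> - 1"
  shows "eisenstein_weight \<kappa> x \<le> eisenstein_weight \<kappa> y"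
proof -
  have "Digamma x \<le> Digamma y" "Digamma (\<kappa> - y) \<le> Digamma (\<kappa> - x)" "Digamma (\<kappa> - x) \<le> Digamma x"
    by (rule Digamma_real_mono; use assms in simp)+
  moreover have "zeta_real y > 0" "zeta_real (\<kappa> - y) > 0" using assms by (auto intro!: zeta_real_pos)
  ultimately show ?thesis unfolding eisenstein_weight_def using assms
    by (intro add_mono mult_mono zeta_pair_mono zeta_pair_deriv_mono) auto
qed

lemma eisenstein_weight_pos:
  assumes "\<kappa> > 2" "\<kappa> / 2 < x" "x < \<kappa> - 1"
  shows "eisenstein_weight \<kappa> x > 0"
proof -
  have "Digamma (\<kappa> - x) < Digamma x" by (rule Digamma_real_strict_mono) (use assms in auto)
  moreover have "zeta_real x > 0" "zeta_real (\<kappa> - x) > 0" using assms by (auto intro!: zeta_real_pos)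
  moreover have "zeta_pair_deriv \<kappa> x \<ge> 0" using assms by (intro zeta_pair_deriv_nonneg) auto
  ultimately show ?thesis unfolding eisenstein_weight_def by (intro add_pos_nonneg mult_pos_pos) auto
qed

section \<open>Antireciprocal polynomials with increasing coefficients\<close>

text \<open>Multiplying by \<open>1 - w\<close> turns the coefficients into nonnegative increments
  of \<open>B\<close>, apart from the top one \<open>- B M\<close>, whose term dominates all others
  when \<open>norm w > 1\<close>.\<close>

lemma Enestroem_Kakeya:
  fixes B :: "nat \<Rightarrow> real" and w :: complex
  assumes B0: "0 \<le> B 0" and mono: "\<And>j. j < M \<Longrightarrow> B j \<le> B (Suc j)" and BM: "B M > 0" and w: "norm w > 1"
  shows "(\<Sum>j\<le>M. of_real (B j) * w ^ j) \<noteq> 0"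
proof
  assume zero: "(\<Sum>j\<le>M. of_real (B j) * w ^ j) = 0"
  \<comment> \<open>The quantity bounded is \<open>1 - w\<close> times a partial sum without its top
    term. Each step adds one increment of \<open>B\<close>, and \<open>norm w > 1\<close> lifts the
    old bound to the next power.\<close>
  have "norm ((1 - w) * (\<Sum>j\<le>m. of_real (B j) * w ^ j) + of_real (B m) * w ^ Suc m) \<le> B m * norm w ^ m" if "m \<le> M" for m
    using that
  proof (induction m)
    case (Suc m)
    have "(1 - w) * (\<Sum>j\<le>Suc m. of_real (B j) * w ^ j) + of_real (B (Suc m)) * w ^ Suc (Suc m)
       = ((1 - w) * (\<Sum>j\<le>m. of_real (B j) * w ^ j) + of_real (B m) * w ^ Suc m) + of_real (B (Suc m) - B m) * w ^ Suc m"
      by (simp add: algebra_simps)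
    also have "norm \<dots> \<le> B m * norm w ^ m + (B (Suc m) - B m) * norm w ^ Suc m"
      using Suc mono[of m] by (intro norm_triangle_mono) (auto simp: norm_mult norm_power simp del: of_real_diff power_Suc)
    also have "B m * norm w ^ m \<le> B m * norm w ^ Suc m"
    proof (rule mult_left_mono)
      show "norm w ^ m \<le> norm w ^ Suc m" using w by (intro power_increasing) auto
      have "0 \<le> B i" if "i \<le> M" for i
        using that
      proof (induction i)
        case (Suc i)
        thus ?case using mono[of i] by simp
      qed (rule B0)
      thus "0 \<le> B m" using Suc by simp
    qed
    finally show ?case by (simp add: algebra_simps)
  qed (use B0 in \<open>simp add: algebra_simps\<close>)
  from this[of M] zero have "B M * norm w ^ Suc M \<le> B M * norm w ^ M"
    using BM by (simp add: norm_mult norm_power)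
  moreover have "norm w ^ M < norm w ^ Suc M" using w by (intro power_strict_increasing) auto
  ultimately show False using BM by (simp add: mult_le_cancel_left)
qed

text \<open>The estimate behind Blaschke factors: the difference of the squared norms is
  \<open>((norm w)^2 - 1) * (1 - (norm r)^2)\<close>.\<close>

lemma norm_one_minus_mult_le:
  fixes r w :: complex
  assumes r: "norm r \<le> 1" and w: "norm w \<ge> 1"
  shows "norm (1 - r * w) \<le> norm (cnj w - r)"
proof -
  have "(norm (cnj w - r))\<^sup>2 - (norm (1 - r * w))\<^sup>2 = ((norm w)\<^sup>2 - 1) * (1 - (norm r)\<^sup>2)"
    unfolding cmod_power2 by (simp add: power2_eq_square algebra_simps)
  moreover have "((norm w)\<^sup>2 - 1) * (1 - (norm r)\<^sup>2) \<ge> 0"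
    using one_le_power[OF w, of 2] power_le_one[OF norm_ge_zero r, of 2] by (intro mult_nonneg_nonneg) linarith+
  ultimately have "(norm (1 - r * w))\<^sup>2 \<le> (norm (cnj w - r))\<^sup>2" by linarith
  thus ?thesis by (rule power2_le_imp_le) simp
qed

text \<open>With \<open>q\<close> the polynomial with coefficients \<open>B j\<close>, the sum is
  \<open>w^M * (q(1/w) - q(w))\<close> for \<open>w\<close> nonzero, and the roots of
  \<open>q\<close> lie in the closed unit disc. For \<open>norm w > 1\<close> the Blaschke estimate
  bounds \<open>w^M * q(1/w)\<close> by the norm of \<open>q(w)\<close>, which is smaller than that
  of \<open>w^M * q(w)\<close>, so the two parts cannot cancel.\<close>

lemma antireciprocal_zeros_on_unit_circle:
  fixes B :: "nat \<Rightarrow> real" and w :: complex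
  assumes M: "M \<ge> 1" and B0: "0 \<le> B 0" and mono: "\<And>j. j < M \<Longrightarrow> B j \<le> B (Suc j)" and BM: "B M > 0"
    and zero: "(\<Sum>j\<le>M. of_real (B j) * (w ^ (M - j) - w ^ (M + j))) = 0"
  shows "norm w = 1"
proof -
  define q where "q = (\<Sum>j\<le>M. monom (complex_of_real (B j)) j)"
  have poly_q: "poly q v = (\<Sum>j\<le>M. of_real (B j) * v ^ j)" for v
    by (simp add: q_def poly_sum poly_monom)
  have coeff_q: "coeff q i = (if i \<le> M then of_real (B i) else 0)" for i
    by (simp add: q_def coeff_sum)
  have deg: "degree q = M"
    using BM by (intro antisym degree_le le_degree) (auto simp: coeff_q)
  obtain r where "smult (lead_coeff q) (\<Prod>i<degree q. [:- r i, 1:]) = q"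
    using complex_poly_decompose' by blast
  hence q: "q = smult (of_real (B M)) (\<Prod>i<M. [:- r i, 1:])" by (simp add: deg coeff_q)
  have fact: "poly q v = of_real (B M) * (\<Prod>i<M. v - r i)" for v
    by (subst q) (simp add: poly_prod)
  have r: "norm (r i) \<le> 1" if "i < M" for i
  proof (rule ccontr)
    assume "\<not> norm (r i) \<le> 1"
    hence "poly q (r i) \<noteq> 0" unfolding poly_q using Enestroem_Kakeya[of B M "r i"] B0 mono BM by auto
    moreover have "poly q (r i) = 0" unfolding fact using that by auto
    ultimately show False by simp
  qed
  have outside: "(\<Sum>j\<le>M. of_real (B j) * (v ^ (M - j) - v ^ (M + j))) \<noteq> 0" if v: "norm v > 1" for v :: complex
  proof
    assume *: "(\<Sum>j\<le>M. of_real (B j) * (v ^ (M - j) - v ^ (M + j))) = 0"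
    have v0: "v \<noteq> 0" using v by auto
    have "v ^ M * poly q (1 / v) = (\<Sum>j\<le>M. of_real (B j) * v ^ (M - j))"
      unfolding poly_q sum_distrib_left
      by (intro sum.cong refl) (use v0 in \<open>simp add: power_diff power_one_over field_simps\<close>)
    moreover have "v ^ M * poly q v = (\<Sum>j\<le>M. of_real (B j) * v ^ (M + j))"
      unfolding poly_q sum_distrib_left by (intro sum.cong refl) (simp add: power_add)
    ultimately have eq: "v ^ M * poly q v = v ^ M * poly q (1 / v)"
      using * by (simp add: algebra_simps sum_subtractf)
    have "v ^ M * poly q (1 / v) = of_real (B M) * (\<Prod>i<M. 1 - r i * v)"
    proof -
      have "v ^ M * (\<Prod>i<M. 1 / v - r i) = (\<Prod>i<M. v * (1 / v - r i))"
        by (simp add: prod.distrib)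
      also have "\<dots> = (\<Prod>i<M. 1 - r i * v)"
        using v0 by (intro prod.cong refl) (simp add: field_simps)
      finally show ?thesis unfolding fact by (simp add: mult_ac)
    qed
    also have "norm \<dots> \<le> B M * (\<Prod>i<M. norm (cnj v - r i))"
      unfolding norm_mult prod_norm[symmetric] using BM v r
      by (intro mult_mono prod_mono conjI norm_one_minus_mult_le prod_nonneg) auto
    also have "\<dots> = norm (poly q (cnj v))"
      unfolding fact norm_mult prod_norm[symmetric] using BM by simp
    \<comment> \<open>The coefficients of \<open>q\<close> are real, so conjugating the argument
      preserves the norm.\<close>
    also have "poly q (cnj v) = cnj (poly q v)"
      by (simp add: poly_q)
    finally have "norm v ^ M * norm (poly q v) \<le> norm (poly q v)"
      unfolding eq[symmetric] by (simp add: norm_mult norm_power)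
    moreover have "poly q v \<noteq> 0" unfolding poly_q using Enestroem_Kakeya[of B M v] B0 mono BM v by auto
    moreover have "norm v ^ M > 1" using v M by (intro one_less_power) auto
    ultimately show False by (simp add: mult_le_cancel_right1)
  qed
  consider "norm w > 1" | "norm w = 1" | "w = 0" | "0 < norm w" "norm w < 1" by force
  thus ?thesis
  proof cases
    case 3
    \<comment> \<open>At \<open>w = 0\<close> only \<open>j = M\<close> survives, through
      \<open>w ^ 0 = 1\<close>.\<close>
    have "(\<Sum>j\<le>M. of_real (B j) * (w ^ (M - j) - w ^ (M + j))) = (\<Sum>j\<le>M. if j = M then complex_of_real (B j) else 0)"
      using M 3 by (intro sum.cong refl) (auto simp: power_0_left)
    thus ?thesis using zero BM by simp
  next
    case 4
    \<comment> \<open>Inversion swaps the two powers up to sign, so a zero inside the disc would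
      give one outside.\<close>
    have "(\<Sum>j\<le>M. of_real (B j) * ((1/w) ^ (M - j) - (1/w) ^ (M + j))) = - (\<Sum>j\<le>M. of_real (B j) * (w ^ (M - j) - w ^ (M + j))) / w ^ (2 * M)"
      unfolding sum_negf[symmetric] sum_divide_distrib
    proof (intro sum.cong refl)
      fix j assume "j \<in> {..M}"
      hence j: "j \<le> M" by simp
      have "w ^ (2 * M) = w ^ (M - j) * w ^ (M + j)" using j by (simp flip: power_add add: mult_2)
      thus "of_real (B j) * ((1/w) ^ (M - j) - (1/w) ^ (M + j)) = - (of_real (B j) * (w ^ (M - j) - w ^ (M + j))) / w ^ (2 * M)"
        using 4 by (simp add: field_simps power_one_over)
    qed
    also have "\<dots> = 0" using zero by simp
    finally show ?thesis using outside[of "1 / w"] 4 by (simp add: norm_divide)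
  qed (use outside zero in auto)
qed

section \<open>The period polynomial\<close>

text \<open>The functional equation at \<open>s - k + 1\<close>. As 4 divides \<open>k\<close>, the
  shift by \<open>k\<close> moves the sine by a multiple of \<open>2 * pi\<close>, the shift by 1
  turns it into a cosine, and the powers of \<open>2 * pi\<close> cancel.\<close>

lemma zeta_cont_shifted:
  fixes k :: nat
  assumes k: "4 dvd k" and s: "Re s < real k - 1"
  shows "of_real ((2 * pi) ^ k) * of_real (2 * pi) powr (-s) * zeta_cont (s - of_nat k + 1)
    = 2 * cos (of_real pi * s / 2) * Gamma (of_nat k - s) * zeta_series (of_nat k - s)"
proof -
  obtain l where l: "k = 4 * l" using k by (elim dvdE)
  have "of_real pi * (s - of_nat k + 1) / 2 = of_real pi * s / 2 + of_real (pi / 2) - of_real (2 * real l * pi)"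
    by (simp add: l field_simps)
  also have "sin \<dots> = cos (of_real pi * s / 2)"
    unfolding sin_diff sin_add cos_add sin_of_real cos_of_real by (simp add: sin_2npi cos_2npi del: of_real_mult)
  finally have sin: "sin (of_real pi * (s - of_nat k + 1) / 2) = cos (of_real pi * s / 2)" .
  have "of_real (2 * pi) powr (-s) * of_real (2 * pi) powr (s - of_nat k) = of_real (2 * pi) powr (- of_nat k :: complex)"
    by (subst powr_add[symmetric]) simp
  also have "\<dots> = inverse (of_real ((2 * pi) ^ k))"
    unfolding powr_minus by (subst powr_nat') (auto simp: powr_complexpow)
  finally have inv: "of_real (2 * pi) powr (-s) * of_real (2 * pi) powr (s - of_nat k) = inverse (complex_of_real ((2 * pi) ^ k))" .
  have p: "of_real ((2 * pi) ^ k) * (of_real (2 * pi) powr (-s) * of_real (2 * pi) powr (s - of_nat k)) = (1 :: complex)"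
    unfolding inv by (rule right_inverse) simp
  have "zeta_cont (s - of_nat k + 1) = zeta_reflected (s - of_nat k + 1)"
    by (rule zeta_cont_left) (use s in simp)
  also have "\<dots> = of_real (2 * pi) powr (s - of_nat k) * (2 * cos (of_real pi * s / 2) * Gamma (of_nat k - s) * zeta_series (of_nat k - s))"
    unfolding zeta_reflected_def sin by (simp add: algebra_simps)
  finally have "of_real ((2 * pi) ^ k) * of_real (2 * pi) powr (-s) * zeta_cont (s - of_nat k + 1) =
     of_real ((2 * pi) ^ k) * (of_real (2 * pi) powr (-s) * of_real (2 * pi) powr (s - of_nat k)) *
       (2 * cos (of_real pi * s / 2) * Gamma (of_nat k - s) * zeta_series (of_nat k - s))"
    by (simp only: mult_ac)
  thus ?thesis unfolding p by simp
qed

text \<open>On the strip \<open>1 < Re s < k - 1\<close>, where both zeta series converge, the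
  completed function is \<open>G\<close>. At \<open>s = 2 * m\<close> the cosine has value
  \<open>(-1) ^ m\<close> and derivative 0, so only the Gamma and zeta factors contribute to the
  product rule.\<close>

lemma deriv_completed_L_eisenstein:
  fixes k m :: nat
  assumes k: "4 dvd k" and m: "1 \<le> m" "2 * m + 2 \<le> k"
  shows "deriv (completed_L (eisenstein k)) (of_nat (2 * m)) =
     of_real (2 / (zeta (real k) * Gamma (real k)) * (-1) ^ m * (Gamma (real (2 * m)) * Gamma (real (k - 2 * m))) *
       eisenstein_weight (real k) (real (2 * m)))"
proof -
  define C where "C = 1 / (zeta (real k) * Gamma (real k))"
  define g where "g = (\<lambda>s. of_real ((2 * pi) ^ k / (zeta (real k) * Gamma (real k))) *
     of_real (2 * pi) powr (-s) * Gamma s * (zeta_cont s * zeta_cont (s - of_nat k + 1)))"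
  define G where "G = (\<lambda>s. of_real (2 * C) * cos (of_real pi * s / 2) * (Gamma s * Gamma (of_nat k - s)) * (zeta_series s * zeta_series (of_nat k - s)))"
  define T where "T = {s. Re s > 1} \<inter> {s. Re s < real k - 1}"
  have "open T" unfolding T_def by (intro open_Int open_halfspace_Re_gt open_halfspace_Re_lt)
  have gG: "g s = G s" if "s \<in> T" for s
  proof -
    have "g s = of_real C * Gamma s * zeta_cont s * (of_real ((2 * pi) ^ k) * of_real (2 * pi) powr (-s) * zeta_cont (s - of_nat k + 1))"
      by (simp add: g_def C_def)
    also have "\<dots> = G s" using that zeta_cont_shifted[OF k, of s] zeta_cont_right[of s]
      by (simp add: T_def G_def)
    finally show ?thesis .
  qed
  have "(\<lambda>s. zeta_series (of_nat k - s)) holomorphic_on T"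
    by (rule holomorphic_on_compose_gen[OF _ holomorphic_zeta_series, unfolded o_def])
       (auto intro!: holomorphic_intros simp: T_def)
  moreover have "zeta_series holomorphic_on T"
    by (rule holomorphic_on_subset[OF holomorphic_zeta_series]) (auto simp: T_def)
  ultimately have "G holomorphic_on T"
    unfolding G_def by (intro holomorphic_intros) (auto simp: T_def elim!: nonpos_Ints_cases simp: complex_eq_iff)
  hence "g holomorphic_on T" by (rule holomorphic_transform) (simp add: gG)
  hence "g analytic_on T" using \<open>open T\<close> by (simp add: analytic_on_open)
  define z where "z = (of_nat (2 * m) :: complex)"
  define x where "x = real (2 * m)"
  have zx: "z = of_real x" "of_nat k - z = of_real (real k - x)" by (simp_all add: z_def x_def)
  have x: "x \<ge> 2" "real k - x \<ge> 2" using m by (simp_all add: x_def)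
  have z: "z \<in> T" using x by (simp add: T_def zx)
  have "deriv (completed_L (eisenstein k)) z = deriv g z"
  proof -
    have "completed_L (eisenstein k) = remove_sings g"
      unfolding g_def by (rule completed_L_eisenstein) (use m in simp)
    moreover have "g analytic_on {z}" by (rule analytic_on_subset[OF \<open>g analytic_on T\<close>]) (use z in simp)
    ultimately show ?thesis by simp
  qed
  also have "\<dots> = deriv G z"
    by (rule deriv_cong_ev) (use \<open>open T\<close> z gG eventually_nhds_in_open[of T z] in \<open>auto elim!: eventually_mono\<close>)
  also have "\<dots> = of_real (2 * C) * cos (of_real pi * z / 2) *
      ((Gamma z * Gamma (of_nat k - z)) * (of_real (zeta_real_deriv x) * zeta_series (of_nat k - z) - zeta_series z * of_real (zeta_real_deriv (real k - x)))
      + (Gamma z * Gamma (of_nat k - z)) * (Digamma z - Digamma (of_nat k - z)) * (zeta_series z * zeta_series (of_nat k - z)))"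
  proof (rule DERIV_imp_deriv)
    have "sin (of_real pi * z / 2) = 0"
    proof -
      have "of_real pi * z / 2 = complex_of_real (real m * pi)" by (simp add: z_def)
      thus ?thesis by (simp only: sin_of_real sin_npi of_real_0)
    qed
    moreover have "((\<lambda>s. cos (of_real pi * s / 2)) has_field_derivative - sin (of_real pi * z / 2) * (of_real pi / 2)) (at z)"
      by (auto intro!: derivative_eq_intros)
    ultimately have c: "((\<lambda>s. cos (of_real pi * s / 2)) has_field_derivative 0) (at z)" by simp
    have np: "complex_of_real y \<notin> \<int>\<^sub>\<le>\<^sub>0" if "y > 0" for y
      using that by (auto elim!: nonpos_Ints_cases simp: complex_eq_iff)
    have "z \<notin> \<int>\<^sub>\<le>\<^sub>0" unfolding zx(1) by (rule np) (use x in simp)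
    moreover have "of_nat k - z \<notin> \<int>\<^sub>\<le>\<^sub>0" unfolding zx(2) by (rule np) (use x in simp)
    ultimately have g: "(Gamma has_field_derivative Gamma z * Digamma z) (at z)"
       "((\<lambda>s. Gamma (of_nat k - s)) has_field_derivative Gamma (of_nat k - z) * Digamma (of_nat k - z) * (- 1)) (at z)"
      by (auto intro!: derivative_eq_intros)
    have z1: "(zeta_series has_field_derivative of_real (zeta_real_deriv x)) (at z)"
      unfolding zx(1) by (rule zeta_real_deriv_LIMSEQ) (use x in simp)
    have "((\<lambda>s. of_nat k - s) has_field_derivative -1) (at z)" by (auto intro!: derivative_eq_intros)
    moreover have "(zeta_series has_field_derivative of_real (zeta_real_deriv (real k - x))) (at (of_nat k - z))"
      unfolding zx(2) by (rule zeta_real_deriv_LIMSEQ) (use x in simp)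
    ultimately have z2: "((\<lambda>s. zeta_series (of_nat k - s)) has_field_derivative of_real (zeta_real_deriv (real k - x)) * (-1)) (at z)"
      by (intro DERIV_chain2)
    show "(G has_field_derivative of_real (2 * C) * cos (of_real pi * z / 2) *
      ((Gamma z * Gamma (of_nat k - z)) * (of_real (zeta_real_deriv x) * zeta_series (of_nat k - z) - zeta_series z * of_real (zeta_real_deriv (real k - x)))
      + (Gamma z * Gamma (of_nat k - z)) * (Digamma z - Digamma (of_nat k - z)) * (zeta_series z * zeta_series (of_nat k - z)))) (at z)"
      unfolding G_def by (rule derivative_eq_intros c g z1 z2 refl)+ (simp add: algebra_simps)
  qed
  also have "cos (of_real pi * z / 2) = of_real ((-1) ^ m)"
  proof -
    have "of_real pi * z / 2 = complex_of_real (real m * pi)" by (simp add: z_def)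
    thus ?thesis by (simp only: cos_of_real cos_npi)
  qed
  also have "of_real (2 * C) * of_real ((-1) ^ m) *
      ((Gamma z * Gamma (of_nat k - z)) * (of_real (zeta_real_deriv x) * zeta_series (of_nat k - z) - zeta_series z * of_real (zeta_real_deriv (real k - x)))
      + (Gamma z * Gamma (of_nat k - z)) * (Digamma z - Digamma (of_nat k - z)) * (zeta_series z * zeta_series (of_nat k - z)))
    = of_real (2 * C * (-1) ^ m * (Gamma x * Gamma (real k - x)) * eisenstein_weight (real k) x)"
  proof -
    have real: "zeta_series (of_real y) = of_real (zeta_real y)" "Gamma (of_real y) = complex_of_real (Gamma y)"
        "Digamma (of_real y) = complex_of_real (Digamma y)" if "y \<ge> 2" for y
      using that by (auto intro!: zeta_real_LIMSEQ(2) Gamma_complex_of_real Polygamma_of_real elim!: nonpos_Ints_cases)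
    show ?thesis
      unfolding zx(2) unfolding zx(1) real[OF x(1)] real[OF x(2)]
      by (simp add: eisenstein_weight_def zeta_pair_deriv_def algebra_simps)
  qed
  also have "real k - x = real (k - 2 * m)" using m by (simp add: x_def of_nat_diff)
  finally show ?thesis by (simp add: z_def x_def C_def)
qed

section \<open>The period polynomial as a polynomial in \<open>z^2\<close>\<close>

lemma odd_indices:
  fixes k :: nat
  assumes "even k" "k \<ge> 4"
  shows "{n. n \<in> {1..k-3} \<and> odd n} = (\<lambda>m. 2 * m - 1) ` {1..k div 2 - 1}"
proof (intro equalityI subsetI)
  fix n assume "n \<in> {n. n \<in> {1..k-3} \<and> odd n}"
  hence n: "1 \<le> n" "n \<le> k - 3" "odd n" by auto
  then obtain m where "n = 2 * m + 1" by (elim oddE)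
  with n assms show "n \<in> (\<lambda>m. 2 * m - 1) ` {1..k div 2 - 1}"
    by (intro image_eqI[of _ _ "m + 1"]) auto
qed (use assms in auto)

text \<open>For \<open>n = 2 * m - 1\<close> the binomial coefficient times
  \<open>Gamma (2 * m) * Gamma (k - 2 * m)\<close> is \<open>fact (k - 2)\<close>, and the power of
  the imaginary unit is \<open>- ((-1) ^ m)\<close>, which cancels the sign of the cosine. All
  coefficients thus share one constant.\<close>

lemma poly_period_poly_deriv_eisenstein:
  fixes k :: nat
  assumes k: "4 dvd k" "k \<ge> 8"
  shows "poly (period_poly_deriv k (eisenstein k)) z =
    of_real (- 2 * fact (k - 2) / (zeta (real k) * Gamma (real k))) *
      (\<Sum>m=1..k div 2 - 1. of_real (eisenstein_weight (real k) (real (2 * m))) * (z\<^sup>2) ^ (k div 2 - 1 - m))"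
proof -
  have ev: "even k" using k(1) by (metis dvd_trans even_numeral)
  have "poly (period_poly_deriv k (eisenstein k)) z =
     (\<Sum>n | n \<in> {1..k-3} \<and> odd n. of_nat ((k - 2) choose n) * \<i> powi (1 - int n) *
               deriv (completed_L (eisenstein k)) (of_nat (n + 1)) * z ^ (k - 3 - n))"
    unfolding period_poly_deriv_def by (simp add: poly_sum poly_monom)
  also have "\<dots> = (\<Sum>m=1..k div 2 - 1. of_nat ((k - 2) choose (2 * m - 1)) * \<i> powi (1 - int (2 * m - 1)) *
               deriv (completed_L (eisenstein k)) (of_nat (2 * m - 1 + 1)) * z ^ (k - 3 - (2 * m - 1)))"
    using k(2) by (subst odd_indices[OF ev]) (simp, subst sum.reindex, auto simp: inj_on_def)
  also have "\<dots> = (\<Sum>m=1..k div 2 - 1. of_real (- 2 * fact (k - 2) / (zeta (real k) * Gamma (real k))) *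
      (of_real (eisenstein_weight (real k) (real (2 * m))) * (z\<^sup>2) ^ (k div 2 - 1 - m)))"
  proof (intro sum.cong refl)
    fix m assume "m \<in> {1..k div 2 - 1}"
    hence m: "1 \<le> m" "2 * m + 2 \<le> k" using k by auto
    have i: "\<i> powi (1 - int (2 * m - 1)) = of_real (- ((-1) ^ m))"
    proof -
      have "1 - int (2 * m - 1) = 2 * (1 - int m)" using m by (simp add: of_nat_diff)
      hence "\<i> powi (1 - int (2 * m - 1)) = (\<i> powi 2) powi (1 - int m)" by (simp only: power_int_mult)
      also have "\<i> powi 2 = -1" by simp
      also have "(-1 :: complex) powi (1 - int m) = - ((-1) ^ m)"
        by (cases "even m") (simp_all add: power_int_diff)
      finally show ?thesis by simp
    qed
    have "fact (2 * m - 1) * fact (k - 2 - (2 * m - 1)) * ((k - 2) choose (2 * m - 1)) = (fact (k - 2) :: nat)"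
      using m by (intro binomial_fact_lemma) auto
    moreover have "k - 2 - (2 * m - 1) = k - 2 * m - 1" using m by auto
    ultimately have "real (fact (2 * m - 1) * fact (k - 2 * m - 1) * ((k - 2) choose (2 * m - 1))) = real (fact (k - 2))"
      by simp
    moreover have "Gamma (real (2 * m)) = fact (2 * m - 1)" "Gamma (real (k - 2 * m)) = fact (k - 2 * m - 1)"
      using m Gamma_fact[of "2 * m - 1", where ?'a = real] Gamma_fact[of "k - 2 * m - 1", where ?'a = real]
      by (simp_all add: of_nat_diff)
    ultimately have b: "real ((k - 2) choose (2 * m - 1)) * (Gamma (real (2 * m)) * Gamma (real (k - 2 * m))) = fact (k - 2)"
      by (simp add: mult_ac)
    have e: "k - 3 - (2 * m - 1) = 2 * (k div 2 - 1 - m)" using m ev by auto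
    have "of_nat ((k - 2) choose (2 * m - 1)) * \<i> powi (1 - int (2 * m - 1)) * deriv (completed_L (eisenstein k)) (of_nat (2 * m - 1 + 1))
      = complex_of_real (real ((k - 2) choose (2 * m - 1)) * (- ((-1) ^ m)) * (2 / (zeta (real k) * Gamma (real k)) * (-1) ^ m * (Gamma (real (2 * m)) * Gamma (real (k - 2 * m))) *
       eisenstein_weight (real k) (real (2 * m))))"
      unfolding i using deriv_completed_L_eisenstein[OF k(1) m] m by simp
    also have "real ((k - 2) choose (2 * m - 1)) * (- ((-1) ^ m)) * (2 / (zeta (real k) * Gamma (real k)) * (-1) ^ m * (Gamma (real (2 * m)) * Gamma (real (k - 2 * m))) *
       eisenstein_weight (real k) (real (2 * m)))
      = - (((-1) ^ m * (-1) ^ m) * 2 / (zeta (real k) * Gamma (real k))) * (real ((k - 2) choose (2 * m - 1)) * (Gamma (real (2 * m)) * Gamma (real (k - 2 * m)))) * eisenstein_weight (real k) (real (2 * m))"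
      by simp
    also have "\<dots> = - 2 * fact (k - 2) / (zeta (real k) * Gamma (real k)) * eisenstein_weight (real k) (real (2 * m))"
      unfolding b by (simp flip: power_mult_distrib)
    finally show "of_nat ((k - 2) choose (2 * m - 1)) * \<i> powi (1 - int (2 * m - 1)) *
               deriv (completed_L (eisenstein k)) (of_nat (2 * m - 1 + 1)) * z ^ (k - 3 - (2 * m - 1))
       = of_real (- 2 * fact (k - 2) / (zeta (real k) * Gamma (real k))) *
      (of_real (eisenstein_weight (real k) (real (2 * m))) * (z\<^sup>2) ^ (k div 2 - 1 - m))"
      unfolding e power_mult by (simp only: of_real_mult mult.assoc)
  qed
  finally show ?thesis by (simp only: sum_distrib_left)
qed

text \<open>Oddness of \<open>h\<close> about \<open>c\<close> pairs the indices
  \<open>c - j\<close> and \<open>c + j\<close>; the induction adds the two outermost ones. At the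
  centre oddness gives only \<open>h c + h c = 0\<close>, which does not force
  \<open>h c = 0\<close> in a general commutative ring.\<close>

lemma sum_symmetric_split:
  fixes h :: "nat \<Rightarrow> 'a :: comm_ring_1"
  assumes "\<And>j. j \<le> M \<Longrightarrow> h (c - j) = - h (c + j)" "c > M" "h c = 0"
  shows "(\<Sum>m=c-M..c+M. h m * w ^ (c + M - m)) = (\<Sum>j\<le>M. h (c + j) * (w ^ (M - j) - w ^ (M + j)))"
  using assms(1,2)
proof (induction M)
  case 0
  thus ?case using assms(3) by simp
next
  case (Suc M)
  have eq: "{c - Suc M..c + Suc M} = insert (c - Suc M) (insert (c + Suc M) {c - M..c + M})"
    using Suc.prems by auto
  have nm: "c - Suc M \<notin> insert (c + Suc M) {c - M..c + M}" "c + Suc M \<notin> {c - M..c + M}"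
    using Suc.prems by auto
  have "(\<Sum>m=c-Suc M..c+Suc M. h m * w ^ (c + Suc M - m)) =
      h (c - Suc M) * w ^ (c + Suc M - (c - Suc M)) + (h (c + Suc M) * w ^ (c + Suc M - (c + Suc M)) +
        (\<Sum>m=c-M..c+M. h m * w ^ (c + Suc M - m)))"
    using nm by (simp only: eq sum.insert finite_insert finite_atLeastAtMost not_False_eq_True)
  also have "c + Suc M - (c - Suc M) = 2 * Suc M" using Suc.prems by simp
  finally have "(\<Sum>m=c-Suc M..c+Suc M. h m * w ^ (c + Suc M - m)) =
     h (c - Suc M) * w ^ (2 * Suc M) + h (c + Suc M) + (\<Sum>m=c-M..c+M. h m * w ^ (c + Suc M - m))"
    by (simp only: diff_self_eq_0 power_0 mult_1_right add.assoc)
  also have "(\<Sum>m=c-M..c+M. h m * w ^ (c + Suc M - m)) = w * (\<Sum>m=c-M..c+M. h m * w ^ (c + M - m))"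
    unfolding sum_distrib_left by (intro sum.cong refl) (simp add: Suc_diff_le)
  also have "(\<Sum>m=c-M..c+M. h m * w ^ (c + M - m)) = (\<Sum>j\<le>M. h (c + j) * (w ^ (M - j) - w ^ (M + j)))"
    using Suc by simp
  also have "w * \<dots> = (\<Sum>j\<le>M. h (c + j) * (w ^ (Suc M - j) - w ^ (Suc M + j)))"
    unfolding sum_distrib_left by (intro sum.cong refl) (simp add: Suc_diff_le algebra_simps)
  also have "h (c - Suc M) * w ^ (2 * Suc M) + h (c + Suc M) + \<dots> =
      (\<Sum>j\<le>Suc M. h (c + j) * (w ^ (Suc M - j) - w ^ (Suc M + j)))"
    using Suc.prems(1)[of "Suc M"] by (simp add: algebra_simps flip: mult_2)
  finally show ?case .
qed

theorem theorem4p1: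
  fixes k :: nat
  assumes "k > 0" and "[k = 0] (mod 4)"
    and "k \<noteq> 4"
  shows "\<forall>z. poly (period_poly_deriv k (eisenstein k)) z = 0 \<longrightarrow> cmod z = 1"
proof (intro allI impI)
  fix z assume zero: "poly (period_poly_deriv k (eisenstein k)) z = 0"
  have k4: "4 dvd k" using assms(2) by (simp add: cong_0_iff)
  then obtain l where l: "k = 4 * l" by (elim dvdE)
  \<comment> \<open>Excluding \<open>k = 4\<close> leaves \<open>l \<ge> 2\<close>, so that
    \<open>M \<ge> 1\<close> below.\<close>
  have l2: "l \<ge> 2" using assms l by (cases l) auto
  \<comment> \<open>The index range from 1 to \<open>k div 2 - 1\<close> is
    \<open>{l - M..l + M}\<close>; its centre \<open>l\<close> corresponds to the centre of symmetry
    \<open>k / 2 = 2 * l\<close> of the weight.\<close>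
  define M where "M = l - 1"
  define h where "h = (\<lambda>m. eisenstein_weight (real k) (real (2 * m)))"
  \<comment> \<open>Positivity of \<open>zeta k\<close> makes the common constant nonzero, so that
    it can be divided out.\<close>
  have "(\<lambda>n. 1 / real (Suc n) powr real k) = (\<lambda>n. real (Suc n) powr (- real k))"
    by (simp add: powr_minus_divide)
  moreover have "summable (\<lambda>n. real (Suc n) powr (- real k))"
    using l l2 by (intro summable_Suc_powr) simp
  ultimately have "zeta (real k) > 0"
    unfolding zeta_def by (intro suminf_pos) auto
  hence C: "- 2 * fact (k - 2) / (zeta (real k) * Gamma (real k)) \<noteq> 0"
    using assms(1) Gamma_real_pos[of "real k", THEN less_imp_neq] by auto
  have "(\<Sum>m=1..k div 2 - 1. complex_of_real (h m) * (z\<^sup>2) ^ (k div 2 - 1 - m)) = 0"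
    using zero C l l2 unfolding h_def by (subst (asm) poly_period_poly_deriv_eisenstein[OF k4]) auto
  moreover have "k div 2 - 1 = l + M" "{1..l + M} = {l - M..l + M}" using l l2 by (auto simp: M_def)
  ultimately have "(\<Sum>m=l-M..l+M. complex_of_real (h m) * (z\<^sup>2) ^ (l + M - m)) = 0" by (simp only:)
  moreover have "(\<Sum>m=l-M..l+M. complex_of_real (h m) * (z\<^sup>2) ^ (l + M - m)) =
      (\<Sum>j\<le>M. complex_of_real (h (l + j)) * ((z\<^sup>2) ^ (M - j) - (z\<^sup>2) ^ (M + j)))"
  proof (rule sum_symmetric_split)
    have refl: "h (l - j) = - h (l + j)" if "j \<le> l" for j
      using eisenstein_weight_reflect[of "real k" "real (2 * (l + j))"] that by (simp add: h_def l of_nat_diff algebra_simps)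
    thus "complex_of_real (h (l - j)) = - of_real (h (l + j))" if "j \<le> M" for j
      using that by (simp add: M_def)
    show "complex_of_real (h l) = 0" using refl[of 0] by simp
  qed (use l2 in \<open>simp add: M_def\<close>)
  ultimately have "(\<Sum>j\<le>M. complex_of_real (h (l + j)) * ((z\<^sup>2) ^ (M - j) - (z\<^sup>2) ^ (M + j))) = 0" by simp
  hence "norm (z\<^sup>2) = 1"
  proof (rule antireciprocal_zeros_on_unit_circle[rotated 4])
    show "M \<ge> 1" using l2 by (simp add: M_def)
    \<comment> \<open>Oddness forces the weight at the centre to be 0, which gives the lowest
      coefficient.\<close>
    have "eisenstein_weight (real k) (real k - real k / 2) = - eisenstein_weight (real k) (real k / 2)"
      by (rule eisenstein_weight_reflect)
    thus "0 \<le> h (l + 0)" by (simp add: h_def l)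
    show "h (l + j) \<le> h (l + Suc j)" if "j < M" for j
      unfolding h_def using that l l2 by (intro eisenstein_weight_mono) (auto simp: M_def)
    \<comment> \<open>The largest argument is \<open>2 * (l + M) = k - 2\<close>, still below
      \<open>k - 1\<close>.\<close>
    show "h (l + M) > 0"
      unfolding h_def using l l2 by (intro eisenstein_weight_pos) (auto simp: M_def of_nat_diff)
  qed
  thus "cmod z = 1" by (simp add: norm_power power2_eq_1_iff) (use norm_ge_zero[of z] in linarith)
qed

end
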